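(* Let $p\equiv 1\pmod 4$ be prime and let $T^{4,4,1}$ be the matrix with rows and columns indexed by $\binom{\mathbb{F}_p}{2}$ whose entry at $(\{a,b\},\{c,d\})$ equals $\chi(a-c)\chi(a-d)\chi(b-c)\chi(b-d)$ if $\{a,b\}\cap\{c,d\}=\emptyset$ and $0$ otherwise. Then $\|T^{4,4,1}\| = O(p^{5/4})$ as $p\to\infty$.
   Context: $\chi$ denotes the Legendre symbol of $\mathbb{F}_p$ ($\chi(0)=0$, $\chi(x)=1$ for nonzero squares, $-1$ for non-squares). $\binom{\mathbb{F}_p}{2}$ is the set of 2-element subsets of $\mathbb{F}_p$. $\|\cdot\|$ is the operator (spectral) norm. *)

theory Defs
  imports "HOL-Analysis.Analysis" "HOL-Number_Theory.Number_Theory"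
    "HOL-Library.Landau_Symbols"
begin

text \<open>
  The field \<open>\<F>\<^sub>p\<close> is represented by the integer residues \<open>{0..<p}\<close>; the library's
  Legendre symbol depends only on its first argument modulo \<open>p\<close>, so differences may be
  formed in the integers.
\<close>

definition pairs_mod :: "nat \<Rightarrow> int set set" where
  "pairs_mod p = {S. S \<subseteq> {0..<int p} \<and> card S = 2}"

text \<open>For \<open>S = {a, b}\<close> and \<open>U = {c, d}\<close> the product runs over the four pairs
  \<open>(a, c)\<close>, \<open>(a, d)\<close>, \<open>(b, c)\<close>, \<open>(b, d)\<close>.\<close>

definition T441 :: "nat \<Rightarrow> int set \<Rightarrow> int set \<Rightarrow> real" where
  "T441 p S U =
    (if S \<inter> U = {} then \<Prod>x\<in>S. \<Prod>y\<in>U. real_of_int (Legendre (x - y) (int p)) else 0)"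

text \<open>
  The \<open>\<ell>\<^sup>2\<close> operator norm of a real matrix with rows and columns indexed by a finite set
  \<open>I\<close>. It follows the library's \<^const>\<open>onorm\<close>, which is not directly applicable since the
  index set varies with \<open>p\<close>; vectors with \<open>L2_set x I = 0\<close> contribute \<open>0\<close>.
\<close>

definition matrix_opnorm :: "'i set \<Rightarrow> ('i \<Rightarrow> 'i \<Rightarrow> real) \<Rightarrow> real" where
  "matrix_opnorm I A =
    (SUP x. L2_set (\<lambda>i. \<Sum>j\<in>I. A i j * x j) I / L2_set x I)"

lemma T441_doubleton:
  assumes "a \<noteq> b" "c \<noteq> d" "{a, b} \<inter> {c, d} = {}"
  shows "T441 p {a, b} {c, d} = real_of_int
    (Legendre (a - c) (int p) * Legendre (a - d) (int p) *
     Legendre (b - c) (int p) * Legendre (b - d) (int p))"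
  using assms by (simp add: T441_def)

text \<open>The supremum is taken over a bounded set, so it is a genuine one.\<close>

lemma bdd_above_matrix_opnorm:
  fixes A :: "'i \<Rightarrow> 'i \<Rightarrow> real"
  assumes "finite I"
  shows "bdd_above (range (\<lambda>x. L2_set (\<lambda>i. \<Sum>j\<in>I. A i j * x j) I / L2_set x I))"
proof (rule bdd_aboveI2)
  fix x :: "'i \<Rightarrow> real"
  have "\<bar>\<Sum>j\<in>I. A i j * x j\<bar> \<le> L2_set (A i) I * L2_set x I" for i
  proof -
    have "\<bar>\<Sum>j\<in>I. A i j * x j\<bar> \<le> (\<Sum>j\<in>I. \<bar>A i j\<bar> * \<bar>x j\<bar>)"
      by (rule order_trans[OF sum_abs]) (simp add: abs_mult)
    also have "\<dots> \<le> L2_set (A i) I * L2_set x I"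
      by (rule L2_set_mult_ineq)
    finally show ?thesis .
  qed
  then have "(\<Sum>i\<in>I. \<bar>\<Sum>j\<in>I. A i j * x j\<bar>) \<le> (\<Sum>i\<in>I. L2_set (A i) I) * L2_set x I"
    by (simp add: sum_distrib_right sum_mono)
  with L2_set_le_sum_abs
  have "L2_set (\<lambda>i. \<Sum>j\<in>I. A i j * x j) I \<le> (\<Sum>i\<in>I. L2_set (A i) I) * L2_set x I"
    by (rule order_trans)
  then show "L2_set (\<lambda>i. \<Sum>j\<in>I. A i j * x j) I / L2_set x I \<le> (\<Sum>i\<in>I. L2_set (A i) I)"
    by (cases "L2_set x I = 0")
      (simp_all add: sum_nonneg L2_set_nonneg divide_le_eq order_less_le)
qed

end

theory Submission
  imports Defs "HOL-Computational_Algebra.Polynomial"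
begin

text \<open>
  The matrix extends to pairs of points of the projective line, and the extension \<open>T\<close> is invariant
  under \<open>PGL\<^sub>2(\<F>\<^sub>p)\<close>. A nonconstant eigenfunction of \<open>T\<close> generates a representation of dimension at
  least \<open>p - 1\<close>, so a nontrivial eigenvalue \<open>\<lambda>\<close> satisfies \<open>(p - 1) \<lambda>\<^sup>4 \<le> tr T\<^sup>4\<close>. The entries of
  \<open>T\<^sup>2\<close> are \<open>(s\<^sup>2 - O(p)) / 2\<close> with a complete sum \<open>s\<close> of \<open>\<chi>\<close> over a product of four linear factors.
  Summing \<open>s\<^sup>4\<close> over all monic quartics instead of the split ones only enlarges the total, and
  then the values at distinct points become independent: only quadruples of points that coincide
  in pairs contribute, and \<open>tr T\<^sup>4 = O(p\<^sup>6)\<close> without a bound for any single \<open>s\<close>. Hence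
  \<open>\<lambda> = O(p\<^bsup>5/4\<^esup>)\<close>.

  The multiplicity argument is carried out with orthogonal projections onto invariants in place
  of eigenvectors and characters.
\<close>

hide_const (open) UnivPoly.coeff

section \<open>Kernels on a finite set\<close>

definition inner_on :: "'x set \<Rightarrow> ('x \<Rightarrow> real) \<Rightarrow> ('x \<Rightarrow> real) \<Rightarrow> real" where
  "inner_on X u v = (\<Sum>x\<in>X. u x * v x)"

abbreviation norm_sq :: "'x set \<Rightarrow> ('x \<Rightarrow> real) \<Rightarrow> real" where
  "norm_sq X v \<equiv> inner_on X v v"

definition kernel_apply :: "'x set \<Rightarrow> ('x \<Rightarrow> 'x \<Rightarrow> real) \<Rightarrow> ('x \<Rightarrow> real) \<Rightarrow> 'x \<Rightarrow> real" where
  "kernel_apply X K v x = inner_on X (K x) v"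

definition kernel_comp ::
  "'x set \<Rightarrow> ('x \<Rightarrow> 'x \<Rightarrow> real) \<Rightarrow> ('x \<Rightarrow> 'x \<Rightarrow> real) \<Rightarrow> 'x \<Rightarrow> 'x \<Rightarrow> real" where
  "kernel_comp X K L x y = (\<Sum>z\<in>X. K x z * L z y)"

definition frobenius_sq :: "'x set \<Rightarrow> ('x \<Rightarrow> 'x \<Rightarrow> real) \<Rightarrow> real" where
  "frobenius_sq X K = (\<Sum>x\<in>X. \<Sum>y\<in>X. (K x y)\<^sup>2)"

lemma inner_on_commute: "inner_on X u v = inner_on X v u"
  by (simp add: inner_on_def mult.commute)

lemma norm_sq_eq_sum: "norm_sq X v = (\<Sum>x\<in>X. (v x)\<^sup>2)"
  by (simp add: inner_on_def power2_eq_square)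

lemma norm_sq_nonneg: "0 \<le> norm_sq X v"
  by (simp add: norm_sq_eq_sum sum_nonneg)

lemma inner_on_cong:
  "(\<And>x. x \<in> X \<Longrightarrow> u x = u' x) \<Longrightarrow> (\<And>x. x \<in> X \<Longrightarrow> v x = v' x) \<Longrightarrow> inner_on X u v = inner_on X u' v'"
  by (simp add: inner_on_def)

lemma inner_on_diff_left: "inner_on X (\<lambda>x. u x - v x) w = inner_on X u w - inner_on X v w"
  by (simp add: inner_on_def left_diff_distrib sum_subtractf)

lemma inner_on_diff_right: "inner_on X u (\<lambda>x. v x - w x) = inner_on X u v - inner_on X u w"
  by (simp add: inner_on_def right_diff_distrib sum_subtractf)

lemma inner_on_Cauchy_Schwarz: "(inner_on X u v)\<^sup>2 \<le> norm_sq X u * norm_sq X v"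
  unfolding norm_sq_eq_sum inner_on_def by (rule Cauchy_Schwarz_ineq_sum)

lemma two_inner_on_le: "2 * inner_on X u v \<le> norm_sq X u + norm_sq X v"
  using norm_sq_nonneg[of X "\<lambda>x. u x - v x"]
  by (simp add: inner_on_diff_left inner_on_diff_right inner_on_commute[of X v u])

lemma norm_sq_const_add:
  assumes "(\<Sum>x\<in>X. f x) = 0"
  shows "norm_sq X (\<lambda>x. a + f x) = real (card X) * a\<^sup>2 + norm_sq X f"
  using assms by (simp add: norm_sq_eq_sum power2_sum sum.distrib flip: sum_distrib_left)

lemma frobenius_sq_nonneg: "0 \<le> frobenius_sq X K"
  by (simp add: frobenius_sq_def sum_nonneg)

lemma kernel_apply_diff: "kernel_apply X K (\<lambda>x. u x - v x) x =
    kernel_apply X K u x - kernel_apply X K v x"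
  by (simp add: kernel_apply_def inner_on_diff_right)

lemma kernel_apply_comp:
  "kernel_apply X (kernel_comp X K L) v x = kernel_apply X K (kernel_apply X L v) x"
  unfolding kernel_apply_def inner_on_def kernel_comp_def sum_distrib_left sum_distrib_right
  by (subst sum.swap) (simp only: mult.assoc)

lemma norm_sq_kernel_apply_le_frobenius:
  "norm_sq X (kernel_apply X K v) \<le> frobenius_sq X K * norm_sq X v"
  unfolding norm_sq_eq_sum[of X "kernel_apply X K v"] frobenius_sq_def sum_distrib_right
  by (intro sum_mono)
    (use inner_on_Cauchy_Schwarz[of X _ v] in \<open>simp add: kernel_apply_def norm_sq_eq_sum
        flip: sum_distrib_right\<close>)

lemma symmetric_kernel_norm_sq_le:
  assumes "\<And>x y. K x y = K y x"
  shows "(norm_sq X (kernel_apply X K v))\<^sup>2 \<le> norm_sq X v *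
    norm_sq X (kernel_apply X (kernel_comp X K K) v)"
proof -
  have adjoint: "inner_on X (kernel_apply X K v) w = inner_on X v (kernel_apply X K w)" for w
    unfolding inner_on_def kernel_apply_def sum_distrib_left sum_distrib_right
    by (subst sum.swap) (simp add: assms mult_ac)
  have "norm_sq X (kernel_apply X K v) = inner_on X v (kernel_apply X (kernel_comp X K K) v)"
    unfolding adjoint by (intro inner_on_cong) (simp_all add: kernel_apply_comp)
  then show ?thesis by (simp add: inner_on_Cauchy_Schwarz)
qed

definition kernel_invariant :: "'x set \<Rightarrow> ('x \<Rightarrow> 'x \<Rightarrow> real) \<Rightarrow> ('x \<Rightarrow> 'x) \<Rightarrow> bool" where
  "kernel_invariant X K g \<longleftrightarrow> (\<forall>x\<in>X. \<forall>y\<in>X. K (g x) (g y) = K x y)"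

lemma inner_on_bij:
  assumes "bij_betw g X X"
  shows "inner_on X (u \<circ> g) (v \<circ> g) = inner_on X u v"
  unfolding inner_on_def o_def using assms by (rule sum.reindex_bij_betw)

lemma kernel_apply_equivariant:
  assumes "bij_betw g X X" "kernel_invariant X K g" "x \<in> X"
  shows "kernel_apply X K (v \<circ> g) x = kernel_apply X K v (g x)"
proof -
  have "kernel_apply X K (v \<circ> g) x = inner_on X (K (g x) \<circ> g) (v \<circ> g)"
    using assms(2,3) by (simp add: kernel_apply_def kernel_invariant_def inner_on_def)
  also have "\<dots> = kernel_apply X K v (g x)"
    unfolding kernel_apply_def by (rule inner_on_bij[OF assms(1)])
  finally show ?thesis .
qed

lemma norm_sq_kernel_apply_equivariant:
  assumes "bij_betw g X X" "kernel_invariant X K g"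
  shows "norm_sq X (kernel_apply X K (v \<circ> g)) = norm_sq X (kernel_apply X K v)"
proof -
  have "norm_sq X (kernel_apply X K (v \<circ> g)) = norm_sq X (kernel_apply X K v \<circ> g)"
    by (rule inner_on_cong) (simp_all add: kernel_apply_equivariant[OF assms])
  also have "\<dots> = norm_sq X (kernel_apply X K v)"
    by (rule inner_on_bij[OF assms(1)])
  finally show ?thesis .
qed

lemma kernel_invariant_comp:
  assumes "bij_betw g X X" "kernel_invariant X K g" "kernel_invariant X L g"
  shows "kernel_invariant X (kernel_comp X K L) g"
  unfolding kernel_invariant_def
proof (intro ballI)
  fix x y assume xy: "x \<in> X" "y \<in> X"
  have "kernel_comp X K L (g x) (g y) = (\<Sum>z\<in>X. K (g x) (g z) * L (g z) (g y))"
    unfolding kernel_comp_def by (rule sum.reindex_bij_betw[OF assms(1), symmetric])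
  also have "\<dots> = kernel_comp X K L x y"
    using xy assms(2,3) by (simp add: kernel_comp_def kernel_invariant_def)
  finally show "kernel_comp X K L (g x) (g y) = kernel_comp X K L x y" .
qed

lemma norm_sq_submatrix_le:
  fixes K :: "'x \<Rightarrow> 'x \<Rightarrow> real" and \<phi> :: "'i \<Rightarrow> 'x"
  assumes "finite X" and inj: "inj_on \<phi> I" and subset: "\<phi> ` I \<subseteq> X"
  obtains v where "norm_sq X v = norm_sq I x"
    and "norm_sq I (kernel_apply I (\<lambda>i j. K (\<phi> i) (\<phi> j)) x) \<le> norm_sq X (kernel_apply X K v)"
proof
  define v where "v = (\<lambda>y. if y \<in> \<phi> ` I then x (inv_into I \<phi> y) else 0)"
  have v: "v (\<phi> i) = x i" if "i \<in> I" for i using that inj by (simp add: v_def)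
  have restrict: "(\<Sum>y\<in>X. f y) = (\<Sum>i\<in>I. f (\<phi> i))"
    if "\<And>y. y \<notin> \<phi> ` I \<Longrightarrow> f y = 0" for f :: "'x \<Rightarrow> real"
    using sum.mono_neutral_right[OF assms(1) subset, of f] that inj by (simp add: sum.reindex)
  show "norm_sq X v = norm_sq I x"
    unfolding inner_on_def by (subst restrict) (simp_all add: v, simp add: v_def)
  have "kernel_apply X K v (\<phi> i) = kernel_apply I (\<lambda>i j. K (\<phi> i) (\<phi> j)) x i" for i
    unfolding kernel_apply_def inner_on_def by (subst restrict) (simp_all add: v, simp add: v_def)
  then have "norm_sq I (kernel_apply I (\<lambda>i j. K (\<phi> i) (\<phi> j)) x) =
      (\<Sum>y\<in>\<phi> ` I. (kernel_apply X K v y)\<^sup>2)"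
    using inj by (simp add: norm_sq_eq_sum sum.reindex)
  also have "\<dots> \<le> norm_sq X (kernel_apply X K v)"
    unfolding norm_sq_eq_sum using assms by (intro sum_mono2) auto
  finally show "norm_sq I (kernel_apply I (\<lambda>i j. K (\<phi> i) (\<phi> j)) x)
      \<le> norm_sq X (kernel_apply X K v)" .
qed

lemma abs_matrix_opnorm_le:
  fixes A :: "'i \<Rightarrow> 'i \<Rightarrow> real"
  assumes "finite I" "0 \<le> C" and bound: "\<And>x. L2_set (\<lambda>i. \<Sum>j\<in>I. A i j * x j) I \<le> C * L2_set x I"
  shows "\<bar>matrix_opnorm I A\<bar> \<le> C"
proof -
  let ?q = "\<lambda>x. L2_set (\<lambda>i. \<Sum>j\<in>I. A i j * x j) I / L2_set x I"
  have "?q x \<le> C" for x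
    using bound[of x] assms(2)
    by (cases "L2_set x I = 0") (simp_all add: divide_le_eq order_less_le)
  then have "matrix_opnorm I A \<le> C"
    unfolding matrix_opnorm_def by (intro cSUP_least) auto
  moreover have "0 \<le> ?q (\<lambda>_. 0)" by (intro divide_nonneg_nonneg L2_set_nonneg)
  moreover have "?q (\<lambda>_. 0) \<le> matrix_opnorm I A"
    unfolding matrix_opnorm_def by (rule cSUP_upper[OF UNIV_I bdd_above_matrix_opnorm[OF assms(1)]])
  ultimately show ?thesis by linarith
qed

section \<open>Actions of a finite cyclic group\<close>

lemma sum_residues_shift:
  fixes p :: nat and s :: int
  assumes "0 < p"
  shows "(\<Sum>t\<in>{0..<int p}. F ((t + s) mod int p)) = (\<Sum>t\<in>{0..<int p}. F t)"
  by (rule sum.reindex_bij_witness[of _ "\<lambda>t. (t - s) mod int p" "\<lambda>t. (t + s) mod int p"])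
    (use assms in \<open>auto simp: mod_simps\<close>)

locale cyclic_action =
  fixes p :: nat and X :: "'x set" and \<sigma> :: "int \<Rightarrow> 'x \<Rightarrow> 'x"
  assumes p_pos: "0 < p" and finite_X: "finite X"
    and \<sigma>_in: "x \<in> X \<Longrightarrow> \<sigma> t x \<in> X"
    and \<sigma>_0: "x \<in> X \<Longrightarrow> \<sigma> 0 x = x"
    and \<sigma>_add: "x \<in> X \<Longrightarrow> \<sigma> s (\<sigma> t x) = \<sigma> (s + t) x"
    and \<sigma>_mod: "x \<in> X \<Longrightarrow> \<sigma> (t mod int p) x = \<sigma> t x"
begin

lemma bij_\<sigma>: "bij_betw (\<sigma> t) X X"
  by (rule bij_betw_byWitness[of _ "\<sigma> (- t)"]) (auto simp: \<sigma>_in \<sigma>_add \<sigma>_0)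

lemma inner_\<sigma>: "inner_on X (u \<circ> \<sigma> t) (v \<circ> \<sigma> t) = inner_on X u v"
  using bij_\<sigma> by (rule inner_on_bij)

lemma inner_\<sigma>_uminus: "inner_on X u (v \<circ> \<sigma> (- t)) = inner_on X v (u \<circ> \<sigma> t)"
proof -
  have "inner_on X u (v \<circ> \<sigma> (- t)) = inner_on X (u \<circ> \<sigma> t) (v \<circ> \<sigma> (- t) \<circ> \<sigma> t)"
    by (rule inner_\<sigma>[symmetric])
  also have "\<dots> = inner_on X (u \<circ> \<sigma> t) v"
    by (rule inner_on_cong) (simp_all add: \<sigma>_add \<sigma>_0)
  finally show ?thesis by (simp only: inner_on_commute)
qed

definition avg :: "('x \<Rightarrow> real) \<Rightarrow> 'x \<Rightarrow> real" where
  "avg v x = (\<Sum>t\<in>{0..<int p}. v (\<sigma> t x)) / real p"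

definition autocorrelation :: "('x \<Rightarrow> real) \<Rightarrow> int \<Rightarrow> real" where
  "autocorrelation v t = inner_on X v (v \<circ> \<sigma> t)"

lemma avg_\<sigma>:
  assumes "x \<in> X"
  shows "avg v (\<sigma> s x) = avg v x"
proof -
  have "(\<Sum>t\<in>{0..<int p}. v (\<sigma> t (\<sigma> s x))) = (\<Sum>t\<in>{0..<int p}. v (\<sigma> ((t + s) mod int p) x))"
    using assms by (simp add: \<sigma>_add \<sigma>_mod)
  also have "\<dots> = (\<Sum>t\<in>{0..<int p}. v (\<sigma> t x))"
    by (rule sum_residues_shift[OF p_pos])
  finally show ?thesis by (simp add: avg_def)
qed

lemma inner_avg:
  "inner_on X u (avg v) = (\<Sum>t\<in>{0..<int p}. inner_on X u (v \<circ> \<sigma> t)) / real p"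
  unfolding inner_on_def avg_def
  by (subst sum.swap) (simp add: sum_distrib_left sum_divide_distrib)

lemma inner_avg_invariant:
  assumes "\<And>x t. x \<in> X \<Longrightarrow> u (\<sigma> t x) = u x"
  shows "inner_on X u (avg v) = inner_on X u v"
proof -
  have "inner_on X u (v \<circ> \<sigma> t) = inner_on X (u \<circ> \<sigma> t) (v \<circ> \<sigma> t)" for t
    by (rule inner_on_cong) (simp_all add: assms)
  then show ?thesis using p_pos by (simp add: inner_avg inner_\<sigma>)
qed

lemma sum_avg: "(\<Sum>x\<in>X. avg v x) = (\<Sum>x\<in>X. v x)"
  using inner_avg_invariant[of "\<lambda>_. 1" v] by (simp add: inner_on_def)

lemma inner_avg_avg: "inner_on X (avg u) (avg v) = inner_on X u (avg v)"
proof -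
  have "inner_on X (avg v) (avg u) = inner_on X (avg v) u"
    by (rule inner_avg_invariant) (rule avg_\<sigma>)
  then show ?thesis by (simp only: inner_on_commute)
qed

lemma norm_sq_avg_orthogonal:
  "norm_sq X v = norm_sq X (avg v) + norm_sq X (\<lambda>x. v x - avg v x)"
proof -
  have "inner_on X (avg v) v = inner_on X v (avg v)" by (rule inner_on_commute)
  then show ?thesis by (simp add: inner_on_diff_left inner_on_diff_right inner_avg_avg)
qed

lemma avg_diff_avg: "x \<in> X \<Longrightarrow> avg (\<lambda>x. v x - avg v x) x = 0"
  using p_pos by (simp add: avg_def[of "\<lambda>x. v x - avg v x"] avg_\<sigma> sum_subtractf) (simp add: avg_def)

lemma autocorrelation_0: "autocorrelation v 0 = norm_sq X v"
  unfolding autocorrelation_def by (rule inner_on_cong) (simp_all add: \<sigma>_0)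

lemma autocorrelation_mod: "autocorrelation v (t mod int p) = autocorrelation v t"
  unfolding autocorrelation_def by (rule inner_on_cong) (simp_all add: \<sigma>_mod)

lemma sum_autocorrelation:
  "(\<Sum>t\<in>{0..<int p}. autocorrelation v t) = real p * norm_sq X (avg v)"
  unfolding inner_avg_avg using p_pos by (simp add: inner_avg autocorrelation_def)

text \<open>Both sides are inner products with the projection of \<open>u \<otimes> w\<close> onto the invariants of the
  antidiagonal action on \<open>X \<times> X\<close>: on the left of \<open>w \<otimes> u\<close>, on the right of \<open>u \<otimes> w\<close> itself.\<close>

lemma sum_correlation_sq_le:
  "(\<Sum>t\<in>{0..<int p}. (inner_on X u (w \<circ> \<sigma> t))\<^sup>2)
    \<le> (\<Sum>t\<in>{0..<int p}. autocorrelation u t * autocorrelation w t)"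
proof -
  let ?\<tau> = "\<lambda>t. map_prod (\<sigma> (- t)) (\<sigma> t)"
  have \<sigma>_uminus_mod: "\<sigma> (- (t mod int p)) x = \<sigma> (- t) x" if "x \<in> X" for t x
    using \<sigma>_mod[OF that, of "- (t mod int p)"] \<sigma>_mod[OF that, of "- t"] by (simp add: mod_minus_eq)
  interpret antidiagonal: cyclic_action p "X \<times> X" ?\<tau>
    by standard
      (auto simp: p_pos finite_X \<sigma>_in \<sigma>_0 \<sigma>_add \<sigma>_mod \<sigma>_uminus_mod)
  define tensor where "tensor = (\<lambda>(f :: 'x \<Rightarrow> real) (g :: 'x \<Rightarrow> real) (x, y). f x * g y)"
  have inner_tensor: "inner_on (X \<times> X) (tensor a b) (tensor f g \<circ> ?\<tau> t) =
      inner_on X a (f \<circ> \<sigma> (- t)) * inner_on X b (g \<circ> \<sigma> t)" for a b f g t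
    unfolding inner_on_def sum_product sum.cartesian_product
    by (intro sum.cong refl) (auto simp: tensor_def)
  then have inner_avg_tensor:
    "real p * inner_on (X \<times> X) (tensor a b) (antidiagonal.avg (tensor f g)) =
      (\<Sum>t\<in>{0..<int p}. inner_on X f (a \<circ> \<sigma> t) * inner_on X b (g \<circ> \<sigma> t))" for a b f g
    using p_pos by (simp add: antidiagonal.inner_avg inner_\<sigma>_uminus)
  let ?Puw = "antidiagonal.avg (tensor u w)" and ?Pwu = "antidiagonal.avg (tensor w u)"
  have "(\<Sum>t\<in>{0..<int p}. (inner_on X u (w \<circ> \<sigma> t))\<^sup>2) = real p * inner_on (X \<times> X) ?Pwu ?Puw"
    by (simp add: antidiagonal.inner_avg_avg inner_avg_tensor power2_eq_square)
  also have "\<dots> \<le> real p * ((norm_sq (X \<times> X) ?Pwu + norm_sq (X \<times> X) ?Puw) / 2)"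
    using two_inner_on_le[of "X \<times> X" ?Pwu ?Puw] by (intro mult_left_mono) auto
  also have "\<dots> = (\<Sum>t\<in>{0..<int p}. autocorrelation u t * autocorrelation w t)"
  proof -
    have "real p * norm_sq (X \<times> X) ?Pwu =
        (\<Sum>t\<in>{0..<int p}. autocorrelation u t * autocorrelation w t)"
      "real p * norm_sq (X \<times> X) ?Puw = (\<Sum>t\<in>{0..<int p}. autocorrelation u t * autocorrelation w t)"
      by (simp_all add: antidiagonal.inner_avg_avg inner_avg_tensor
          autocorrelation_def mult.commute)
    then show ?thesis by (simp add: field_simps)
  qed
  finally show ?thesis .
qed

end

section \<open>Actions of the affine group\<close>

locale affine_action = cyclic_action p X \<sigma>
  for p :: nat and X :: "'x set" and \<sigma> :: "int \<Rightarrow> 'x \<Rightarrow> 'x" +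
  fixes \<delta> :: "int \<Rightarrow> 'x \<Rightarrow> 'x"
  assumes prime_p: "prime p"
    and bij_\<delta>: "\<alpha> \<in> {1..<int p} \<Longrightarrow> bij_betw (\<delta> \<alpha>) X X"
    and \<delta>_\<sigma>: "\<alpha> \<in> {1..<int p} \<Longrightarrow> x \<in> X \<Longrightarrow> \<delta> \<alpha> (\<sigma> t x) = \<sigma> (\<alpha> * t) (\<delta> \<alpha> x)"
begin

lemma autocorrelation_dilate:
  assumes "\<alpha> \<in> {1..<int p}"
  shows "autocorrelation (w \<circ> \<delta> \<alpha>) t = autocorrelation w (\<alpha> * t)"
proof -
  have "autocorrelation (w \<circ> \<delta> \<alpha>) t = inner_on X (w \<circ> \<delta> \<alpha>) ((w \<circ> \<sigma> (\<alpha> * t)) \<circ> \<delta> \<alpha>)"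
    unfolding autocorrelation_def by (rule inner_on_cong) (simp_all add: \<delta>_\<sigma>[OF assms])
  also have "\<dots> = autocorrelation w (\<alpha> * t)"
    unfolding autocorrelation_def by (rule inner_on_bij[OF bij_\<delta>[OF assms]])
  finally show ?thesis .
qed

lemma sum_autocorrelation_dilates:
  assumes "\<And>x. x \<in> X \<Longrightarrow> avg w x = 0" and t: "t \<in> {0..<int p}"
  shows "(\<Sum>\<alpha>\<in>{1..<int p}. autocorrelation (w \<circ> \<delta> \<alpha>) t) =
    (if t = 0 then real p else 0) * norm_sq X w - norm_sq X w"
proof (cases "t = 0")
  case True
  then show ?thesis
    using p_pos
    by (simp add: autocorrelation_0 inner_on_bij[OF bij_\<delta>] of_nat_diff left_diff_distrib)
next
  case False
  then have "\<not> int p dvd t" using t by (auto dest: zdvd_imp_le)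
  then have "coprime t (int p)"
    using prime_p prime_imp_coprime[of "int p" t] by (simp add: coprime_commute)
  then have bij: "bij_betw (\<lambda>\<alpha>. t * \<alpha> mod int p) {1..<int p} {1..<int p}"
    by (rule bij_betw_int_remainders_mult)
  have "(\<Sum>\<alpha>\<in>{1..<int p}. autocorrelation (w \<circ> \<delta> \<alpha>) t) =
      (\<Sum>\<alpha>\<in>{1..<int p}. autocorrelation w (t * \<alpha> mod int p))"
    by (simp add: autocorrelation_dilate autocorrelation_mod mult.commute)
  also have "\<dots> = (\<Sum>s\<in>{1..<int p}. autocorrelation w s)"
    by (rule sum.reindex_bij_betw[OF bij])
  also have "\<dots> = (\<Sum>s\<in>{0..<int p}. autocorrelation w s) - autocorrelation w 0"
  proof -
    have "{0..<int p} = insert 0 {1..<int p}" using p_pos by auto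
    then show ?thesis by simp
  qed
  also have "(\<Sum>s\<in>{0..<int p}. autocorrelation w s) = 0"
    using assms(1) by (simp add: sum_autocorrelation inner_on_def)
  finally show ?thesis using False by (simp add: autocorrelation_0 o_def)
qed

text \<open>A substitute for Schur orthogonality: every irreducible constituent without translation
  invariants has dimension \<open>p - 1\<close>.\<close>

lemma sum_affine_correlation_sq_le:
  assumes w: "\<And>x. x \<in> X \<Longrightarrow> avg w x = 0"
  shows "(\<Sum>\<alpha>\<in>{1..<int p}. \<Sum>t\<in>{0..<int p}. (inner_on X u (w \<circ> \<delta> \<alpha> \<circ> \<sigma> t))\<^sup>2)
    \<le> real p * norm_sq X u * norm_sq X w"
proof -
  have "(\<Sum>\<alpha>\<in>{1..<int p}. \<Sum>t\<in>{0..<int p}. (inner_on X u (w \<circ> \<delta> \<alpha> \<circ> \<sigma> t))\<^sup>2)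
      \<le> (\<Sum>\<alpha>\<in>{1..<int p}. \<Sum>t\<in>{0..<int p}. autocorrelation u t * autocorrelation (w \<circ> \<delta> \<alpha>) t)"
    by (intro sum_mono sum_correlation_sq_le)
  also have "\<dots> =
      (\<Sum>t\<in>{0..<int p}. autocorrelation u t * (\<Sum>\<alpha>\<in>{1..<int p}. autocorrelation (w \<circ> \<delta> \<alpha>) t))"
    unfolding sum_distrib_left by (rule sum.swap)
  also have "\<dots> = (\<Sum>t\<in>{0..<int p}. (if t = 0 then autocorrelation u t * real p * norm_sq X w else 0)
      - autocorrelation u t * norm_sq X w)"
    by (intro sum.cong refl) (simp add: sum_autocorrelation_dilates[OF w] right_diff_distrib)
  also have "\<dots> = real p * norm_sq X u * norm_sq X w
      - real p * norm_sq X (avg u) * norm_sq X w"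
    using p_pos
    by (simp add: sum_subtractf autocorrelation_0 sum_autocorrelation flip: sum_distrib_right)
  also have "\<dots> \<le> real p * norm_sq X u * norm_sq X w"
    by (simp add: norm_sq_nonneg)
  finally show ?thesis .
qed

lemma norm_sq_kernel_apply_mean_zero_le:
  assumes inv_\<sigma>: "\<And>t. kernel_invariant X K (\<sigma> t)"
    and inv_\<delta>: "\<And>\<alpha>. \<alpha> \<in> {1..<int p} \<Longrightarrow> kernel_invariant X K (\<delta> \<alpha>)"
    and w: "\<And>x. x \<in> X \<Longrightarrow> avg w x = 0"
  shows "real (p - 1) * norm_sq X (kernel_apply X K w) \<le> frobenius_sq X K * norm_sq X w"
proof -
  let ?norm = "\<lambda>v. norm_sq X (kernel_apply X K v)"
  have "?norm (w \<circ> \<delta> \<alpha> \<circ> \<sigma> t) = ?norm w" if "\<alpha> \<in> {1..<int p}" for \<alpha> t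
    using that by (simp only: norm_sq_kernel_apply_equivariant bij_\<sigma> bij_\<delta> inv_\<sigma> inv_\<delta>)
  then have "real p * (real (p - 1) * ?norm w) =
      (\<Sum>\<alpha>\<in>{1..<int p}. \<Sum>t\<in>{0..<int p}. ?norm (w \<circ> \<delta> \<alpha> \<circ> \<sigma> t))"
    using p_pos by simp
  also have "\<dots> = (\<Sum>\<alpha>\<in>{1..<int p}. \<Sum>x\<in>X. \<Sum>t\<in>{0..<int p}. (inner_on X (K x) (w \<circ> \<delta> \<alpha> \<circ> \<sigma> t))\<^sup>2)"
    unfolding norm_sq_eq_sum[of X "kernel_apply X K _"] kernel_apply_def
    by (intro sum.cong refl sum.swap)
  also have "\<dots> = (\<Sum>x\<in>X. \<Sum>\<alpha>\<in>{1..<int p}. \<Sum>t\<in>{0..<int p}. (inner_on X (K x) (w \<circ> \<delta> \<alpha> \<circ> \<sigma> t))\<^sup>2)"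
    by (rule sum.swap)
  also have "\<dots> \<le> (\<Sum>x\<in>X. real p * norm_sq X (K x) * norm_sq X w)"
    by (intro sum_mono sum_affine_correlation_sq_le w)
  also have "\<dots> = real p * (frobenius_sq X K * norm_sq X w)"
    by (simp add: frobenius_sq_def norm_sq_eq_sum[of X "K _"]
        sum_distrib_left sum_distrib_right mult_ac)
  finally show ?thesis using p_pos by simp
qed

end

section \<open>Actions of the projective group\<close>

text \<open>By the Bruhat decomposition, the translations and an inversion \<open>\<iota>\<close> move the base point
  \<open>x\<^sub>0\<close> everywhere.\<close>

locale projective_action = affine_action p X \<sigma> \<delta>
  for p :: nat and X :: "'x set" and \<sigma> \<delta> :: "int \<Rightarrow> 'x \<Rightarrow> 'x" +
  fixes \<iota> :: "'x \<Rightarrow> 'x" and x\<^sub>0 :: 'x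
  assumes bij_\<iota>: "bij_betw \<iota> X X" and x\<^sub>0: "x\<^sub>0 \<in> X"
    and transitive: "x \<in> X \<Longrightarrow> \<exists>s t. x = \<sigma> t (\<iota> (\<sigma> s x\<^sub>0))"
begin

definition invariant :: "('x \<Rightarrow> 'x \<Rightarrow> real) \<Rightarrow> bool" where
  "invariant K \<longleftrightarrow> (\<forall>t. kernel_invariant X K (\<sigma> t)) \<and>
    (\<forall>\<alpha>\<in>{1..<int p}. kernel_invariant X K (\<delta> \<alpha>)) \<and> kernel_invariant X K \<iota>"

lemma invariant_comp: "invariant K \<Longrightarrow> invariant L \<Longrightarrow> invariant (kernel_comp X K L)"
  by (simp add: invariant_def kernel_invariant_comp bij_\<sigma> bij_\<delta> bij_\<iota>)

lemma \<iota>_in: "x \<in> X \<Longrightarrow> \<iota> x \<in> X"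
  using bij_\<iota> by (rule bij_betw_apply)

lemma row_sum_eq:
  assumes K: "invariant K" and x: "x \<in> X"
  shows "(\<Sum>y\<in>X. K x y) = (\<Sum>y\<in>X. K x\<^sub>0 y)"
proof -
  have row_sum_move: "(\<Sum>y\<in>X. K (g z) y) = (\<Sum>y\<in>X. K z y)"
    if "bij_betw g X X" "kernel_invariant X K g" "z \<in> X" for g z
    using kernel_apply_equivariant[OF that, of "\<lambda>_. 1"]
    by (simp add: kernel_apply_def inner_on_def o_def)
  obtain s t where "x = \<sigma> t (\<iota> (\<sigma> s x\<^sub>0))" using transitive[OF x] by blast
  then show ?thesis
    using K by (simp add: invariant_def row_sum_move bij_\<sigma> bij_\<iota> \<sigma>_in \<iota>_in x\<^sub>0)
qed

lemma row_sum_comp: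
  assumes "invariant L"
  shows "(\<Sum>y\<in>X. kernel_comp X K L x\<^sub>0 y) = (\<Sum>y\<in>X. K x\<^sub>0 y) * (\<Sum>y\<in>X. L x\<^sub>0 y)"
  unfolding kernel_comp_def
  by (subst sum.swap) (simp add: row_sum_eq[OF assms] flip: sum_distrib_left sum_distrib_right)

lemma kernel_apply_const_add:
  assumes "invariant K" "x \<in> X"
  shows "kernel_apply X K (\<lambda>y. m + w y) x = (\<Sum>y\<in>X. K x\<^sub>0 y) * m + kernel_apply X K w x"
  using row_sum_eq[OF assms]
  by (simp add: kernel_apply_def inner_on_def distrib_left sum.distrib flip: sum_distrib_right)

lemma sum_kernel_apply_eq_0:
  assumes K: "invariant K" and w: "(\<Sum>y\<in>X. w y) = 0"
  shows "(\<Sum>x\<in>X. kernel_apply X K w x) = 0"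
proof -
  have "invariant (\<lambda>x y. K y x)" using K by (simp add: invariant_def kernel_invariant_def)
  then have column: "(\<Sum>x\<in>X. K x y) = (\<Sum>x\<in>X. K x x\<^sub>0)" if "y \<in> X" for y
    using row_sum_eq that by blast
  have "(\<Sum>x\<in>X. kernel_apply X K w x) = (\<Sum>y\<in>X. (\<Sum>x\<in>X. K x y) * w y)"
    unfolding kernel_apply_def inner_on_def by (subst sum.swap) (simp add: sum_distrib_right)
  then show ?thesis by (simp add: column w flip: sum_distrib_left)
qed

lemma sum_square_subset_ge:
  assumes K: "invariant K" and sym: "\<And>x y. K x y = K y x"
    and nonneg: "\<And>x y. 0 \<le> K x y" and Y: "Y \<subseteq> X"
  shows "(2 * real (card Y) - real (card X)) * (\<Sum>x\<in>X. \<Sum>y\<in>X. K x y)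
    \<le> real (card X) * (\<Sum>x\<in>Y. \<Sum>y\<in>Y. K x y)"
proof -
  define r where "r = (\<Sum>y\<in>X. K x\<^sub>0 y)"
  have row: "(\<Sum>y\<in>X. K x y) = r" if "x \<in> X" for x
    unfolding r_def using K that by (rule row_sum_eq)
  have finite_Y: "finite Y" using Y finite_X by (rule finite_subset)
  have "real (card Y) * r = (\<Sum>x\<in>Y. \<Sum>y\<in>X. K x y)"
    using row Y by (simp add: subset_iff)
  also have "\<dots> = (\<Sum>x\<in>Y. (\<Sum>y\<in>X - Y. K x y) + (\<Sum>y\<in>Y. K x y))"
    by (intro sum.cong refl sum.subset_diff Y finite_X)
  also have "\<dots> = (\<Sum>y\<in>X - Y. \<Sum>x\<in>Y. K y x) + (\<Sum>x\<in>Y. \<Sum>y\<in>Y. K x y)"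
    unfolding sum.distrib by (subst sum.swap) (simp add: sym)
  also have "(\<Sum>y\<in>X - Y. \<Sum>x\<in>Y. K y x) \<le> (\<Sum>y\<in>X - Y. r)"
  proof (rule sum_mono)
    fix y assume "y \<in> X - Y"
    then show "(\<Sum>x\<in>Y. K y x) \<le> r"
      using sum_mono2[OF finite_X Y, of "K y"] nonneg row by simp
  qed
  also have "\<dots> = (real (card X) - real (card Y)) * r"
    using Y finite_Y finite_X by (simp add: card_Diff_subset of_nat_diff card_mono)
  finally have "(2 * real (card Y) - real (card X)) * r \<le> (\<Sum>x\<in>Y. \<Sum>y\<in>Y. K x y)"
    by (simp add: algebra_simps)
  then have "real (card X) * ((2 * real (card Y) - real (card X)) * r)
      \<le> real (card X) * (\<Sum>x\<in>Y. \<Sum>y\<in>Y. K x y)"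
    by (rule mult_left_mono) simp
  then show ?thesis using row by (simp add: mult_ac)
qed

lemma sum_le_double_orbit_sum:
  fixes f :: "'x \<Rightarrow> real"
  assumes f: "\<And>x t. x \<in> X \<Longrightarrow> f (\<sigma> t x) = f x" and nonneg: "\<And>x. 0 \<le> f x"
  shows "(\<Sum>x\<in>X. f x) \<le> real p * (\<Sum>s\<in>{0..<int p}. f (\<iota> (\<sigma> s x\<^sub>0)))"
proof -
  let ?g = "\<lambda>(s, t). \<sigma> t (\<iota> (\<sigma> s x\<^sub>0))" and ?P = "{0..<int p} \<times> {0..<int p}"
  have "X \<subseteq> ?g ` ?P"
  proof
    fix x assume "x \<in> X"
    then obtain s t where "x = \<sigma> t (\<iota> (\<sigma> s x\<^sub>0))" using transitive by blast
    then have "x = ?g (s mod int p, t mod int p)"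
      by (simp add: \<sigma>_mod x\<^sub>0 \<sigma>_in \<iota>_in)
    then show "x \<in> ?g ` ?P" by (rule image_eqI) (use p_pos in auto)
  qed
  then have "(\<Sum>x\<in>X. f x) \<le> (\<Sum>x\<in>?g ` ?P. f x)"
    by (intro sum_mono2) (auto simp: nonneg)
  also have "\<dots> \<le> (\<Sum>st\<in>?P. f (?g st))"
    using sum_image_le[of ?P f ?g] nonneg by (simp add: o_def)
  also have "\<dots> = (\<Sum>s\<in>{0..<int p}. \<Sum>t\<in>{0..<int p}. f (\<sigma> t (\<iota> (\<sigma> s x\<^sub>0))))"
    unfolding sum.cartesian_product by (rule sum.cong) auto
  also have "\<dots> = real p * (\<Sum>s\<in>{0..<int p}. f (\<iota> (\<sigma> s x\<^sub>0)))"
    by (simp add: f x\<^sub>0 \<sigma>_in \<iota>_in sum_distrib_left)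
  finally show ?thesis .
qed

lemma norm_sq_avg_inversion_le:
  assumes v: "\<And>x t. x \<in> X \<Longrightarrow> v (\<sigma> t x) = v x" and v_sum: "(\<Sum>x\<in>X. v x) = 0"
  shows "norm_sq X (avg (v \<circ> \<iota>)) \<le> (1 - 1 / (real p)\<^sup>2) * norm_sq X v"
proof -
  let ?u = "v \<circ> \<iota>"
  let ?d = "\<lambda>x. ?u x - avg ?u x"
  define c where "c = avg ?u x\<^sub>0"
  have "norm_sq X v \<le> real (card X) * (- c)\<^sup>2 + norm_sq X v" by simp
  also have "\<dots> = norm_sq X (\<lambda>x. - c + v x)" by (rule norm_sq_const_add[OF v_sum, symmetric])
  also have "\<dots> = (\<Sum>x\<in>X. (v x - c)\<^sup>2)" by (simp add: norm_sq_eq_sum)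
  also have "\<dots> \<le> real p * (\<Sum>s\<in>{0..<int p}. (v (\<iota> (\<sigma> s x\<^sub>0)) - c)\<^sup>2)"
    by (rule sum_le_double_orbit_sum) (simp_all add: v)
  also have "\<dots> = real p * (\<Sum>s\<in>{0..<int p}. (?d (\<sigma> s x\<^sub>0))\<^sup>2)"
    by (simp add: c_def avg_\<sigma> x\<^sub>0)
  also have "\<dots> \<le> real p * (\<Sum>s\<in>{0..<int p}. norm_sq X ?d)"
    unfolding norm_sq_eq_sum
    by (intro mult_left_mono sum_mono member_le_sum finite_X \<sigma>_in x\<^sub>0) auto
  also have "\<dots> = (real p)\<^sup>2 * (norm_sq X v - norm_sq X (avg ?u))"
    using norm_sq_avg_orthogonal[of ?u] by (simp add: inner_on_bij[OF bij_\<iota>] power2_eq_square)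
  finally show ?thesis using p_pos by (simp add: field_simps)
qed

context
  fixes K :: "'x \<Rightarrow> 'x \<Rightarrow> real" and \<mu> :: real
  assumes K: "invariant K" and frobenius_le: "frobenius_sq X K \<le> real (p - 1) * \<mu>"
begin

definition deficit :: "('x \<Rightarrow> real) \<Rightarrow> real" where
  "deficit v = \<mu> * norm_sq X v - norm_sq X (kernel_apply X K v)"

lemma \<mu>_nonneg: "0 \<le> \<mu>"
proof -
  have "0 \<le> real (p - 1) * \<mu>" using frobenius_sq_nonneg frobenius_le by (rule order_trans)
  then show ?thesis using prime_gt_1_nat[OF prime_p] by (simp add: zero_le_mult_iff)
qed

lemma kernel_apply_avg:
  assumes "x \<in> X"
  shows "kernel_apply X K (avg v) x = avg (kernel_apply X K v) x"
  using kernel_apply_equivariant[OF bij_\<sigma> _ assms, of K _ v] K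
  by (simp add: invariant_def kernel_apply_def inner_avg avg_def)

lemma deficit_avg_le: "deficit (avg v) \<le> deficit v"
proof -
  let ?K = "kernel_apply X K" and ?w = "\<lambda>x. v x - avg v x"
  have norm_split: "norm_sq X (?K v) = norm_sq X (?K (avg v)) + norm_sq X (?K ?w)"
    unfolding norm_sq_avg_orthogonal[of "?K v"]
    by (intro arg_cong2[of _ _ _ _ "(+)"] inner_on_cong)
      (simp_all add: kernel_apply_avg kernel_apply_diff)
  have "real (p - 1) * norm_sq X (?K ?w) \<le> frobenius_sq X K * norm_sq X ?w"
    using K by (intro norm_sq_kernel_apply_mean_zero_le avg_diff_avg) (auto simp: invariant_def)
  also have "\<dots> \<le> real (p - 1) * \<mu> * norm_sq X ?w"
    by (intro mult_right_mono frobenius_le norm_sq_nonneg)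
  finally have "real (p - 1) * norm_sq X (?K ?w) \<le> real (p - 1) * (\<mu> * norm_sq X ?w)"
    by (simp only: mult.assoc)
  then have "norm_sq X (?K ?w) \<le> \<mu> * norm_sq X ?w"
    using prime_gt_1_nat[OF prime_p]
    by (simp only: mult_le_cancel_left_pos of_nat_0_less_iff zero_less_diff)
  then show ?thesis
    unfolding deficit_def norm_sq_avg_orthogonal[of v] norm_split by (simp add: distrib_left)
qed

text \<open>Averaging over translations after an inversion lowers the deficit and contracts, so the
  deficit is nonnegative in the limit, whatever the contraction rate.\<close>

lemma deficit_ge_geometric:
  assumes "\<And>x t. x \<in> X \<Longrightarrow> v (\<sigma> t x) = v x" "(\<Sum>x\<in>X. v x) = 0"
  shows "- frobenius_sq X K * (1 - 1 / (real p)\<^sup>2) ^ n * norm_sq X v \<le> deficit v"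
  using assms
proof (induction n arbitrary: v)
  case 0
  have "0 \<le> \<mu> * norm_sq X v" by (simp add: \<mu>_nonneg norm_sq_nonneg)
  then show ?case
    using norm_sq_kernel_apply_le_frobenius[of X K v] by (simp add: deficit_def)
next
  case (Suc n)
  let ?r = "1 - 1 / (real p)\<^sup>2" and ?u = "avg (v \<circ> \<iota>)"
  have r: "0 \<le> ?r" using p_pos by (simp add: field_simps)
  have "- frobenius_sq X K * ?r ^ Suc n * norm_sq X v =
      - (frobenius_sq X K * ?r ^ n * (?r * norm_sq X v))" by simp
  also have "\<dots> \<le> - (frobenius_sq X K * ?r ^ n * norm_sq X ?u)"
    using norm_sq_avg_inversion_le[OF Suc.prems] r
    by (intro le_imp_neg_le mult_left_mono) (simp_all add: frobenius_sq_nonneg)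
  also have "\<dots> = - frobenius_sq X K * ?r ^ n * norm_sq X ?u" by simp
  also have "\<dots> \<le> deficit ?u"
  proof (rule Suc.IH)
    show "(\<Sum>x\<in>X. ?u x) = 0"
      using Suc.prems(2) sum.reindex_bij_betw[OF bij_\<iota>, of v] by (simp add: sum_avg)
  qed (rule avg_\<sigma>)
  also have "\<dots> \<le> deficit (v \<circ> \<iota>)" by (rule deficit_avg_le)
  also have "\<dots> = deficit v"
    using K
    by (simp add: deficit_def invariant_def inner_on_bij bij_\<iota> norm_sq_kernel_apply_equivariant)
  finally show ?case .
qed

lemma deficit_nonneg_sum_zero:
  assumes "(\<Sum>x\<in>X. v x) = 0"
  shows "0 \<le> deficit v"
proof -
  let ?r = "1 - 1 / (real p)\<^sup>2"
  have "\<bar>?r\<bar> < 1" using p_pos by (simp add: field_simps)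
  then have "(\<lambda>n. - frobenius_sq X K * ?r ^ n * norm_sq X (avg v)) \<longlonglongrightarrow>
      - frobenius_sq X K * 0 * norm_sq X (avg v)"
    by (intro tendsto_intros LIMSEQ_power_zero) simp
  then have "0 \<le> deficit (avg v)"
    using deficit_ge_geometric[of "avg v"] assms
    by (intro LIMSEQ_le_const2[of _ 0]) (auto simp: avg_\<sigma> sum_avg)
  also have "\<dots> \<le> deficit v" by (rule deficit_avg_le)
  finally show ?thesis .
qed

theorem norm_sq_kernel_apply_invariant_le:
  assumes row_sum: "(\<Sum>y\<in>X. K x\<^sub>0 y)\<^sup>2 \<le> \<mu>"
  shows "norm_sq X (kernel_apply X K v) \<le> \<mu> * norm_sq X v"
proof -
  define m where "m = (\<Sum>x\<in>X. v x) / real (card X)"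
  define w where "w = (\<lambda>x. v x - m)"
  define r where "r = (\<Sum>y\<in>X. K x\<^sub>0 y)"
  let ?K = "kernel_apply X K"
  have v: "v = (\<lambda>x. m + w x)" by (simp add: w_def)
  have "card X > 0" using x\<^sub>0 finite_X by (auto simp: card_gt_0_iff)
  then have w_sum: "(\<Sum>x\<in>X. w x) = 0" by (simp add: w_def m_def sum_subtractf)
  have "norm_sq X (?K v) = norm_sq X (\<lambda>x. r * m + ?K w x)"
    unfolding v r_def by (intro inner_on_cong kernel_apply_const_add K)
  also have "\<dots> = real (card X) * (r * m)\<^sup>2 + norm_sq X (?K w)"
    by (intro norm_sq_const_add sum_kernel_apply_eq_0 K w_sum)
  also have "\<dots> \<le> \<mu> * (real (card X) * m\<^sup>2) + \<mu> * norm_sq X w"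
  proof (rule add_mono)
    show "real (card X) * (r * m)\<^sup>2 \<le> \<mu> * (real (card X) * m\<^sup>2)"
      using mult_right_mono[OF row_sum, of "real (card X) * m\<^sup>2"]
      by (simp add: r_def power_mult_distrib mult_ac)
    show "norm_sq X (?K w) \<le> \<mu> * norm_sq X w"
      using deficit_nonneg_sum_zero[OF w_sum] by (simp add: deficit_def)
  qed
  also have "\<dots> = \<mu> * norm_sq X v"
    unfolding v using norm_sq_const_add[OF w_sum, of m] by (simp add: distrib_left)
  finally show ?thesis .
qed

end

end

section \<open>The Legendre symbol\<close>

lemma Legendre_cong:
  assumes "[a = b] (mod q)"
  shows "Legendre a q = Legendre b q"
  using assms by (simp add: Legendre_def QuadRes_def cong_def)

lemma Legendre_values: "Legendre a q \<in> {-1, 0, 1}"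
  by (simp add: Legendre_def)

lemma cong_sign_values_imp_eq:
  fixes s t m :: int
  assumes "2 < m" "[s = t] (mod m)" "s \<in> {-1, 0, 1}" "t \<in> {-1, 0, 1}"
  shows "s = t"
proof (rule ccontr)
  assume "s \<noteq> t"
  then have "m \<le> \<bar>s - t\<bar>"
    using assms(2) by (intro zdvd_imp_le) (auto simp: cong_iff_dvd_diff)
  then show False using assms by auto
qed

lemma residue_dvd_diff_iff:
  fixes s t m :: int
  assumes "s \<in> {0..<m}" "t \<in> {0..<m}"
  shows "m dvd s - t \<longleftrightarrow> s = t"
  using assms by (auto simp: mod_eq_dvd_iff[symmetric])

lemma degree_prod_list_linear: "degree (\<Prod>y\<leftarrow>ys. [:- y, 1:]) = length ys"
  for ys :: "'a::idom list"
proof (induction ys)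
  case (Cons y ys)
  have "(\<Prod>y\<leftarrow>ys. [:- y, 1:]) \<noteq> 0"
    by (auto simp: prod_list_zero_iff)
  then show ?case
    using Cons by (simp add: degree_mult_eq del: mult_pCons_left)
qed simp

lemma poly_prod_list_linear: "poly (\<Prod>y\<leftarrow>ys. [:- y, 1:]) x = (\<Prod>y\<leftarrow>ys. x - y)"
  for x :: "'a::comm_ring_1"
  by (induction ys) (simp_all add: algebra_simps)

locale odd_prime =
  fixes p :: nat
  assumes prime_p: "prime p" and p_gt_2: "2 < p"
begin

abbreviation F :: "int set" where "F \<equiv> {0..<int p}"

definition chi :: "int \<Rightarrow> real" where "chi a = of_int (Legendre a (int p))"

lemma p_pos: "0 < p"
  using p_gt_2 by simp

lemma mod_in_F: "a mod int p \<in> F"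
  using p_pos by simp

lemma coprime_p_iff: "coprime a (int p) \<longleftrightarrow> \<not> int p dvd a"
proof
  show "coprime a (int p) \<Longrightarrow> \<not> int p dvd a"
    using p_gt_2 coprime_common_divisor[of a "int p" "int p"] by auto
  show "\<not> int p dvd a \<Longrightarrow> coprime a (int p)"
    using prime_p prime_imp_coprime[of "int p" a] by (simp add: coprime_commute)
qed

lemma chi_cong: "[a = b] (mod int p) \<Longrightarrow> chi a = chi b"
  by (simp add: chi_def Legendre_cong)

lemma chi_mod: "chi (a mod int p) = chi a"
  by (rule chi_cong) simp

lemma chi_0: "int p dvd a \<Longrightarrow> chi a = 0"
  by (simp add: chi_def Legendre_def cong_0_iff)

lemma chi_sq: "\<not> int p dvd a \<Longrightarrow> (chi a)\<^sup>2 = 1"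
  by (simp add: chi_def Legendre_def cong_0_iff)

lemma abs_chi_le_1: "\<bar>chi a\<bar> \<le> 1"
  by (simp add: chi_def Legendre_def)

lemma chi_mult: "chi (a * b) = chi a * chi b"
proof -
  let ?L = "\<lambda>a. Legendre a (int p)"
  note euler = euler_criterion[OF prime_p p_gt_2]
  have "?L (a * b) = ?L a * ?L b"
  proof (rule cong_sign_values_imp_eq)
    have "[?L a * ?L b = (a * b) ^ ((p - 1) div 2)] (mod int p)"
      unfolding power_mult_distrib by (intro cong_mult euler)
    then show "[?L (a * b) = ?L a * ?L b] (mod int p)"
      using euler[of "a * b"] by (simp only: cong_def)
    show "?L a * ?L b \<in> {-1, 0, 1}"
      using Legendre_values[of a "int p"] Legendre_values[of b "int p"] by auto
  qed (use p_gt_2 Legendre_values in auto)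
  then show ?thesis by (simp add: chi_def)
qed

lemma sum_residues_mult:
  assumes "\<not> int p dvd a"
  shows "(\<Sum>t\<in>F. f (a * t mod int p)) = (\<Sum>t\<in>F. f t)"
proof -
  have "bij_betw (\<lambda>t. a * t mod int p) {1..<int p} {1..<int p}"
    using assms by (intro bij_betw_int_remainders_mult) (simp add: coprime_p_iff)
  then have "(\<Sum>t\<in>{1..<int p}. f (a * t mod int p)) = (\<Sum>t\<in>{1..<int p}. f t)"
    by (rule sum.reindex_bij_betw)
  moreover have "F = insert 0 {1..<int p}" using p_pos by auto
  ultimately show ?thesis by simp
qed

lemma exists_nonresidue: "\<exists>g. chi g = -1"
proof (rule ccontr)
  assume none: "\<nexists>g. chi g = -1"
  let ?sq = "\<lambda>y. y\<^sup>2 mod int p"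
  have "F \<subseteq> ?sq ` F"
  proof
    fix a assume a: "a \<in> F"
    have "Legendre a (int p) \<noteq> -1" using none unfolding chi_def by (metis of_int_1 of_int_minus)
    then have "QuadRes (int p) a \<or> [0\<^sup>2 = a] (mod int p)"
      by (auto simp: Legendre_def cong_sym_eq split: if_splits)
    then obtain y where "[y\<^sup>2 = a] (mod int p)" unfolding QuadRes_def by blast
    then have "y\<^sup>2 mod int p = a" using a by (simp add: cong_def)
    then show "a \<in> ?sq ` F"
      by (intro image_eqI[of _ _ "y mod int p"]) (simp_all add: power_mod p_pos)
  qed
  moreover have "?sq ` F \<subseteq> F" using mod_in_F by blast
  ultimately have "?sq ` F = F" by blast
  then have inj: "inj_on ?sq F" by (intro eq_card_imp_inj_on) simp_all
  have "?sq 1 = ?sq (int p - 1)"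
    by (simp add: mod_eq_dvd_iff power2_eq_square algebra_simps)
  then have "1 = int p - 1"
    by (rule inj_onD[OF inj]) (use p_gt_2 in auto)
  then show False using p_gt_2 by simp
qed

lemma sum_chi: "(\<Sum>a\<in>F. chi a) = 0"
proof -
  obtain g where g: "chi g = -1" using exists_nonresidue by blast
  then have "\<not> int p dvd g" using chi_0 by force
  then have "(\<Sum>a\<in>F. chi (g * a)) = (\<Sum>a\<in>F. chi a)"
    using sum_residues_mult[of g chi] by (simp add: chi_mod)
  then show ?thesis by (simp add: chi_mult g sum_negf)
qed

lemma sum_chi_affine:
  assumes "\<not> int p dvd a"
  shows "(\<Sum>t\<in>F. chi (b + t * a)) = 0"
proof -
  have "(\<Sum>t\<in>F. chi (b + t * a)) = (\<Sum>t\<in>F. chi ((a * t mod int p + b) mod int p))"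
    by (intro sum.cong refl chi_cong) (simp add: cong_def mod_simps algebra_simps)
  also have "\<dots> = (\<Sum>t\<in>F. chi ((t + b) mod int p))"
    by (rule sum_residues_mult[OF assms, of "\<lambda>t. chi ((t + b) mod int p)"])
  also have "\<dots> = 0"
    by (simp only: sum_residues_shift[OF p_pos] sum_chi)
  finally show ?thesis .
qed

section \<open>The fourth moment of character sums over polynomials\<close>

definition coeff_vectors :: "nat \<Rightarrow> (nat \<Rightarrow> int) set" where
  "coeff_vectors n = {..<n} \<rightarrow>\<^sub>E F"

definition eval_coeffs :: "nat \<Rightarrow> (nat \<Rightarrow> int) \<Rightarrow> int \<Rightarrow> int" where
  "eval_coeffs n c x = (\<Sum>i<n. c i * x ^ i)"

lemma card_coeff_vectors: "card (coeff_vectors n) = p ^ n"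
  by (simp add: coeff_vectors_def card_PiE)

lemma finite_coeff_vectors: "finite (coeff_vectors n)"
  by (simp add: coeff_vectors_def finite_PiE)

definition translate_coeffs :: "nat \<Rightarrow> int \<Rightarrow> int poly \<Rightarrow> (nat \<Rightarrow> int) \<Rightarrow> nat \<Rightarrow> int" where
  "translate_coeffs n s g c = (\<lambda>i\<in>{..<n}. (c i + s * coeff g i) mod int p)"

lemma sum_translate_coeffs:
  "(\<Sum>c\<in>coeff_vectors n. f (translate_coeffs n s g c)) = (\<Sum>c\<in>coeff_vectors n. f c)"
proof (rule sum.reindex_bij_witness[of _ "translate_coeffs n (- s) g" "translate_coeffs n s g"])
  have inverse: "translate_coeffs n s g (translate_coeffs n (- s) g c) = c"
    if c: "c \<in> coeff_vectors n" for c s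
  proof
    fix i
    show "translate_coeffs n s g (translate_coeffs n (- s) g c) i = c i"
    proof (cases "i < n")
      case True
      then have "c i \<in> F" using c PiE_mem unfolding coeff_vectors_def by fast
      then show ?thesis using True by (simp add: translate_coeffs_def mod_simps)
    next
      case False
      then have "c i = undefined" using c PiE_arb[of c "{..<n}"] unfolding coeff_vectors_def by simp
      then show ?thesis using False by (simp add: translate_coeffs_def)
    qed
  qed
  fix c assume "c \<in> coeff_vectors n"
  then show "translate_coeffs n s g (translate_coeffs n (- s) g c) = c"
    "translate_coeffs n (- s) g (translate_coeffs n s g c) = c"
    using inverse[of c s] inverse[of c "- s"] by simp_all
qed (auto simp: translate_coeffs_def coeff_vectors_def p_pos)

lemma eval_translate_coeffs:
  assumes "degree g < n"
  shows "[eval_coeffs n (translate_coeffs n s g c) x =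
      eval_coeffs n c x + s * poly g x] (mod int p)"
proof -
  have "poly g x = (\<Sum>i<n. coeff g i * x ^ i)"
    unfolding poly_altdef using assms
    by (intro sum.mono_neutral_left) (auto simp: coeff_eq_0)
  then have "eval_coeffs n c x + s * poly g x = (\<Sum>i<n. (c i + s * coeff g i) * x ^ i)"
    by (simp add: eval_coeffs_def sum_distrib_left distrib_right sum.distrib mult.assoc)
  moreover have "[eval_coeffs n (translate_coeffs n s g c) x =
      (\<Sum>i<n. (c i + s * coeff g i) * x ^ i)] (mod int p)"
    unfolding eval_coeffs_def by (intro cong_sum cong_mult) (auto simp: translate_coeffs_def)
  ultimately show ?thesis by simp
qed

lemma not_dvd_prod_list_diff:
  assumes "x \<in> F" "set ys \<subseteq> F - {x}"
  shows "\<not> int p dvd (\<Prod>y\<leftarrow>ys. x - y)"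
  using assms(2)
proof (induction ys)
  case (Cons y ys)
  then have "\<not> int p dvd x - y"
    using assms(1) by (subst residue_dvd_diff_iff) auto
  then show ?case using Cons prime_p by (simp add: prime_dvd_mult_iff)
qed (use p_gt_2 in simp)

text \<open>Adding multiples of \<open>\<Prod>y\<leftarrow>ys. X - y\<close> to the polynomial changes only its value at \<open>x\<close>,
  which then runs through all residues.\<close>

lemma sum_coeffs_chi_isolated_point:
  fixes h :: "int \<Rightarrow> int"
  assumes x: "x \<in> F" and ys: "set ys \<subseteq> F - {x}" "length ys < n"
  shows "(\<Sum>c\<in>coeff_vectors n. chi (h x + eval_coeffs n c x) *
    (\<Prod>y\<leftarrow>ys. chi (h y + eval_coeffs n c y))) = 0"
proof -
  define g :: "int poly" where "g = (\<Prod>y\<leftarrow>ys. [:- y, 1:])"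
  let ?v = "\<lambda>c z. h z + eval_coeffs n c z"
  let ?w = "\<lambda>c. \<Prod>y\<leftarrow>ys. chi (?v c y)"
  let ?c = "\<lambda>s c. translate_coeffs n s g c"
  have value_translate: "chi (?v (?c s c) z) = chi (?v c z + s * poly g z)" for s c z
    using eval_translate_coeffs[of g n s c z] ys(2)
    by (intro chi_cong) (simp add: g_def degree_prod_list_linear cong_add_lcancel add.assoc)
  have unchanged: "?w (?c s c) = ?w c" for s c
  proof -
    have "poly g y = 0" if "y \<in> set ys" for y
      using that by (auto simp: g_def poly_prod_list_linear prod_list_zero_iff)
    then show ?thesis
      by (intro arg_cong[of _ _ prod_list] map_cong refl) (simp add: value_translate)
  qed
  have "\<not> int p dvd poly g x"
    using not_dvd_prod_list_diff[OF x ys(1)] by (simp add: g_def poly_prod_list_linear)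
  then have "0 = (\<Sum>c\<in>coeff_vectors n. ?w c * (\<Sum>s\<in>F. chi (?v c x + s * poly g x)))"
    by (simp add: sum_chi_affine)
  also have "\<dots> = (\<Sum>s\<in>F. \<Sum>c\<in>coeff_vectors n. chi (?v (?c s c) x) * ?w (?c s c))"
    unfolding sum_distrib_left
    by (subst sum.swap) (simp only: value_translate[where z = x] unchanged mult.commute)
  also have "\<dots> = real p * (\<Sum>c\<in>coeff_vectors n. chi (?v c x) * ?w c)"
    using sum_translate_coeffs[of "\<lambda>c. chi (?v c x) * ?w c"] by simp
  finally show ?thesis using p_pos by simp
qed

lemma sum_coeffs_chi_quadruple_le_power:
  fixes h :: "int \<Rightarrow> int" and n :: nat
  defines "\<psi> \<equiv> \<lambda>c u. chi (h u + eval_coeffs n c u)"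
  shows "(\<Sum>c\<in>coeff_vectors n. \<psi> c x * \<psi> c y * \<psi> c z * \<psi> c w) \<le> real p ^ n"
proof -
  have "\<bar>\<psi> c u\<bar> \<le> 1" for c u unfolding \<psi>_def by (rule abs_chi_le_1)
  then have "\<bar>\<psi> c x * \<psi> c y * \<psi> c z * \<psi> c w\<bar> \<le> 1 * 1 * 1 * 1" for c
    unfolding abs_mult by (intro mult_mono) auto
  then have "\<psi> c x * \<psi> c y * \<psi> c z * \<psi> c w \<le> 1" for c
    using abs_le_D1[of "\<psi> c x * \<psi> c y * \<psi> c z * \<psi> c w" 1] by (simp only: mult_1)
  then show ?thesis
    using sum_bounded_above[of "coeff_vectors n" "\<lambda>c. \<psi> c x * \<psi> c y * \<psi> c z * \<psi> c w" 1]
    by (simp add: card_coeff_vectors)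
qed

lemma sum_coeffs_chi_quadruple_le:
  fixes h :: "int \<Rightarrow> int"
  assumes in_F: "{x, y, z, w} \<subseteq> F" and n: "4 \<le> n"
  defines "\<psi> \<equiv> \<lambda>c u. chi (h u + eval_coeffs n c u)"
  shows "(\<Sum>c\<in>coeff_vectors n. \<psi> c x * \<psi> c y * \<psi> c z * \<psi> c w) \<le> real p ^ n *
    (of_bool (x = y \<and> z = w) + of_bool (x = z \<and> y = w) + of_bool (x = w \<and> y = z))"
    (is "?S \<le> real p ^ n * ?pairings")
proof (cases "x = y \<and> z = w \<or> x = z \<and> y = w \<or> x = w \<and> y = z")
  case True
  then have "1 \<le> ?pairings" by auto
  from mult_left_mono[OF this, of "real p ^ n"] have "real p ^ n \<le> real p ^ n * ?pairings" by simp
  with sum_coeffs_chi_quadruple_le_power show ?thesis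
    unfolding \<psi>_def by (rule order_trans)
next
  case False
  have isolated: "(\<Sum>c\<in>coeff_vectors n. \<psi> c a * (\<psi> c b * (\<psi> c d * \<psi> c e))) = 0"
    if "{a, b, d, e} \<subseteq> F" "a \<notin> {b, d, e}" for a b d e
    using sum_coeffs_chi_isolated_point[of a "[b, d, e]" n h] that n by (simp add: \<psi>_def)
  from False consider "x \<notin> {y, z, w}" | "y \<notin> {x, z, w}" | "z \<notin> {x, y, w}" | "w \<notin> {x, y, z}"
    by blast
  then have vanishes: "?S = 0"
  proof cases
    case 1
    then show ?thesis using isolated[of x y z w] in_F by (simp add: mult_ac)
  next
    case 2
    then show ?thesis using isolated[of y x z w] in_F by (simp add: mult_ac)
  next
    case 3
    then show ?thesis using isolated[of z x y w] in_F by (simp add: mult_ac)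
  next
    case 4
    then show ?thesis using isolated[of w x y z] in_F by (simp add: mult_ac)
  qed
  show ?thesis
    unfolding vanishes by (intro mult_nonneg_nonneg add_nonneg_nonneg) simp_all
qed

lemma sum_pairings_residues:
  "(\<Sum>x\<in>F. \<Sum>y\<in>F. \<Sum>z\<in>F. \<Sum>w\<in>F.
    of_bool (x = y \<and> z = w) + of_bool (x = z \<and> y = w) + of_bool (x = w \<and> y = z)) = 3 * (real p)\<^sup>2"
proof -
  have "(\<Sum>u\<in>F. of_bool (t = u)) = (1 :: real)" if "t \<in> F" for t
    using that by (simp add: of_bool_def)
  then show ?thesis
    by (simp add: sum.distrib of_bool_conj power2_eq_square
        flip: sum_distrib_left sum_distrib_right)
qed

lemma fourth_moment_coeffs:
  fixes h :: "int \<Rightarrow> int"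
  assumes "4 \<le> n"
  shows "(\<Sum>c\<in>coeff_vectors n. (\<Sum>x\<in>F. chi (h x + eval_coeffs n c x)) ^ 4) \<le> 3 * real p ^ (n + 2)"
proof -
  let ?\<psi> = "\<lambda>c x. chi (h x + eval_coeffs n c x)" and ?F4 = "F \<times> F \<times> F \<times> F"
  let ?pairings = "\<lambda>x y z w.
    of_bool (x = y \<and> z = w) + of_bool (x = z \<and> y = w) + of_bool (x = w \<and> y = z) :: real"
  have "(\<Sum>x\<in>F. ?\<psi> c x) ^ 4 =
      (\<Sum>x\<in>F. \<Sum>y\<in>F. \<Sum>z\<in>F. \<Sum>w\<in>F. ?\<psi> c x * ?\<psi> c y * ?\<psi> c z * ?\<psi> c w)" for c
    by (simp only: power4_eq_xxxx flip: sum_distrib_left sum_distrib_right)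
  then have "(\<Sum>c\<in>coeff_vectors n. (\<Sum>x\<in>F. ?\<psi> c x) ^ 4) =
      (\<Sum>c\<in>coeff_vectors n. \<Sum>(x, y, z, w)\<in>?F4. ?\<psi> c x * ?\<psi> c y * ?\<psi> c z * ?\<psi> c w)"
    by (simp add: sum.cartesian_product)
  also have "\<dots> = (\<Sum>(x, y, z, w)\<in>?F4. \<Sum>c\<in>coeff_vectors n. ?\<psi> c x * ?\<psi> c y * ?\<psi> c z * ?\<psi> c w)"
    by (subst sum.swap) (simp add: case_prod_beta)
  also have "\<dots> \<le> (\<Sum>(x, y, z, w)\<in>?F4. real p ^ n * ?pairings x y z w)"
    by (intro sum_mono) (use sum_coeffs_chi_quadruple_le[OF _ assms, of _ _ _ _ h] in auto)
  also have "\<dots> = real p ^ n * (\<Sum>x\<in>F. \<Sum>y\<in>F. \<Sum>z\<in>F. \<Sum>w\<in>F. ?pairings x y z w)"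
    by (simp add: sum.cartesian_product sum_distrib_left case_prod_beta)
  finally show ?thesis by (simp only: sum_pairings_residues power_add mult_ac)
qed

definition reduced_coeffs :: "nat \<Rightarrow> int poly \<Rightarrow> nat \<Rightarrow> int" where
  "reduced_coeffs n f = (\<lambda>k\<in>{..<n}. coeff f k mod int p)"

lemma reduced_coeffs_in: "reduced_coeffs n f \<in> coeff_vectors n"
  unfolding reduced_coeffs_def coeff_vectors_def
  by (intro restrict_PiE_iff[THEN iffD2] ballI mod_in_F)

lemma poly_cong_reduced_coeffs:
  assumes "degree f = n" "lead_coeff f = 1"
  shows "[poly f x = x ^ n + eval_coeffs n (reduced_coeffs n f) x] (mod int p)"
proof -
  have "poly f x = x ^ n + (\<Sum>k<n. coeff f k * x ^ k)"
    using assms by (simp add: poly_altdef lessThan_Suc_atMost[symmetric])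
  also have "[\<dots> = x ^ n + eval_coeffs n (reduced_coeffs n f) x] (mod int p)"
    unfolding eval_coeffs_def
    by (intro cong_add cong_sum cong_mult cong_refl) (simp add: reduced_coeffs_def cong_def)
  finally show ?thesis .
qed

lemma fourth_moment_monic_family:
  fixes R :: "'i \<Rightarrow> int poly" and m :: nat
  assumes "finite I" "4 \<le> n"
    and monic: "\<And>i. i \<in> I \<Longrightarrow> degree (R i) = n" "\<And>i. i \<in> I \<Longrightarrow> lead_coeff (R i) = 1"
    and fibres: "\<And>i. i \<in> I \<Longrightarrow> card {j \<in> I. \<forall>x. [poly (R j) x = poly (R i) x] (mod int p)} \<le> m"
  shows "(\<Sum>i\<in>I. (\<Sum>x\<in>F. chi (poly (R i) x)) ^ 4) \<le> 3 * real m * real p ^ (n + 2)"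
proof -
  define M where "M = (\<lambda>c. (\<Sum>x\<in>F. chi (x ^ n + eval_coeffs n c x)) ^ 4)"
  let ?red = "\<lambda>i. reduced_coeffs n (R i)"
  note poly_red = poly_cong_reduced_coeffs[OF monic]
  have card_fibre: "card {j \<in> I. ?red j = c} \<le> m" for c
  proof (cases "\<exists>i\<in>I. ?red i = c")
    case True
    then obtain i where i: "i \<in> I" "?red i = c" by blast
    then have "{j \<in> I. ?red j = c} \<subseteq> {j \<in> I. \<forall>x. [poly (R j) x = poly (R i) x] (mod int p)}"
      using poly_red by (auto simp: cong_def)
    then have "card {j \<in> I. ?red j = c} \<le>
        card {j \<in> I. \<forall>x. [poly (R j) x = poly (R i) x] (mod int p)}"
      using assms(1) by (intro card_mono) simp_all
    then show ?thesis using fibres[OF i(1)] by (rule le_trans)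
  next
    case False
    then have "{j \<in> I. ?red j = c} = {}" by blast
    then show ?thesis by (simp only: card.empty le0)
  qed
  have "(\<Sum>i\<in>I. (\<Sum>x\<in>F. chi (poly (R i) x)) ^ 4) = (\<Sum>i\<in>I. M (?red i))"
    unfolding M_def by (intro sum.cong arg_cong2[of _ _ _ _ "(^)"] refl chi_cong poly_red)
  also have "\<dots> = (\<Sum>c\<in>coeff_vectors n. \<Sum>i\<in>{i \<in> I. ?red i = c}. M (?red i))"
    using reduced_coeffs_in
    by (intro sum.group[symmetric] assms(1) finite_coeff_vectors) auto
  also have "\<dots> = (\<Sum>c\<in>coeff_vectors n. real (card {i \<in> I. ?red i = c}) * M c)"
    by (intro sum.cong refl) simp
  also have "\<dots> \<le> (\<Sum>c\<in>coeff_vectors n. real m * M c)"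
    using card_fibre by (intro sum_mono mult_right_mono) (simp_all add: M_def)
  also have "\<dots> \<le> real m * (3 * real p ^ (n + 2))"
    unfolding sum_distrib_left[symmetric] M_def
    by (intro mult_left_mono fourth_moment_coeffs assms) simp
  finally show ?thesis by (simp add: mult_ac)
qed

end

section \<open>The projective line\<close>

lemma sum_prod_pairs:
  fixes k :: "'a \<Rightarrow> 'b::comm_ring_1"
  assumes "finite A"
  shows "2 * (\<Sum>R | R \<subseteq> A \<and> card R = 2. \<Prod>x\<in>R. k x) = (\<Sum>x\<in>A. k x)\<^sup>2 - (\<Sum>x\<in>A. (k x)\<^sup>2)"
  using assms
proof (induction A)
  case (insert a A)
  have "{R. R \<subseteq> insert a A \<and> card R = 2} = {R. R \<subseteq> A \<and> card R = 2} \<union> (\<lambda>b. {a, b}) ` A"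
    using insert.hyps by (auto simp: card_2_iff)
  moreover have "{R. R \<subseteq> A \<and> card R = 2} \<inter> (\<lambda>b. {a, b}) ` A = {}"
    using insert.hyps by auto
  moreover have "inj_on (\<lambda>b. {a, b}) A"
    by (auto simp: inj_on_def doubleton_eq_iff)
  moreover have "(\<Sum>b\<in>A. \<Prod>x\<in>{a, b}. k x) = k a * (\<Sum>b\<in>A. k b)"
    unfolding sum_distrib_left using insert.hyps by (intro sum.cong refl) (subst prod.insert, auto)
  ultimately have "(\<Sum>R | R \<subseteq> insert a A \<and> card R = 2. \<Prod>x\<in>R. k x) =
      (\<Sum>R | R \<subseteq> A \<and> card R = 2. \<Prod>x\<in>R. k x) + k a * (\<Sum>b\<in>A. k b)"
    using insert.hyps by (simp add: sum.union_disjoint sum.reindex)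
  then show ?case
    using insert by (simp add: power2_sum algebra_simps)
qed (simp cong: conj_cong)

lemma card_pairs:
  assumes "finite A"
  shows "2 * real (card {R. R \<subseteq> A \<and> card R = 2}) = real (card A) * (real (card A) - 1)"
  using sum_prod_pairs[OF assms, of "\<lambda>_. 1"] by (simp add: power2_eq_square algebra_simps)

locale paley_prime = odd_prime +
  assumes p_mod_4: "p mod 4 = 1"
begin

lemma p_ge_5: "5 \<le> p"
  using p_mod_4 p_gt_2 by presburger

lemma chi_uminus: "chi (- a) = chi a"
proof -
  have "(p - 1) div 2 = 2 * (p div 4)" using p_mod_4 by presburger
  then have "[Legendre (-1) (int p) = 1] (mod int p)"
    using euler_criterion[OF prime_p p_gt_2, of "-1"] by simp
  then have "Legendre (-1) (int p) = 1"
    by (rule cong_sign_values_imp_eq[rotated]) (use p_gt_2 Legendre_values in auto)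
  then show ?thesis using chi_mult[of "-1" a] by (simp add: chi_def)
qed

lemma chi_diff_commute: "chi (a - b) = chi (b - a)"
  using chi_uminus[of "a - b"] by simp

lemma chi_prod: "chi (\<Prod>x\<in>A. f x) = (\<Prod>x\<in>A. chi (f x))"
proof -
  have "chi 1 = 1"
    using chi_mult[of 1 1] chi_sq[of 1] p_gt_2 by auto
  then show ?thesis
    by (induction A rule: infinite_finite_induct) (simp_all add: chi_mult)
qed

lemma not_dvd_nonzero_residue: "a \<in> F \<Longrightarrow> a \<noteq> 0 \<Longrightarrow> \<not> int p dvd a"
  using residue_dvd_diff_iff[of a "int p" 0] p_pos by simp

text \<open>Here \<open>None\<close> is the point at infinity.\<close>

definition P1 :: "int option set" where
  "P1 = insert None (Some ` F)"

lemma None_in_P1 [simp]: "None \<in> P1"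
  by (simp add: P1_def)

lemma Some_in_P1 [simp]: "Some a \<in> P1 \<longleftrightarrow> a \<in> F"
  by (auto simp: P1_def)

lemma finite_P1: "finite P1"
  by (simp add: P1_def)

lemma sum_P1: "(\<Sum>x\<in>P1. f x) = f None + (\<Sum>a\<in>F. f (Some a))"
  by (simp add: P1_def sum.reindex image_iff)

lemma card_P1: "card P1 = p + 1"
  by (simp add: P1_def card_image image_iff)

fun \<kappa> :: "int option \<Rightarrow> int option \<Rightarrow> real" where
  "\<kappa> None None = 0"
| "\<kappa> None (Some b) = 1"
| "\<kappa> (Some a) None = 1"
| "\<kappa> (Some a) (Some b) = chi (a - b)"

lemma \<kappa>_commute: "\<kappa> x y = \<kappa> y x"
  by (cases x; cases y) (simp_all add: chi_diff_commute)

lemma \<kappa>_same [simp]: "\<kappa> x x = 0"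
  by (cases x) (simp_all add: chi_0)

text \<open>A Moebius transformation \<open>g\<close> with determinant \<open>\<Delta>\<close> and denominator \<open>\<gamma> x + \<eta>\<close> satisfies
  \<open>g x - g y = \<Delta> (x - y) / ((\<gamma> x + \<eta>) (\<gamma> y + \<eta>))\<close>; this is what remains of it after
  applying \<open>chi\<close>.\<close>

definition \<kappa>_conformal :: "(int option \<Rightarrow> int option) \<Rightarrow> bool" where
  "\<kappa>_conformal g \<longleftrightarrow> bij_betw g P1 P1 \<and> (\<exists>d c. d\<^sup>2 = 1 \<and> (\<forall>x\<in>P1. (c x)\<^sup>2 = 1) \<and>
    (\<forall>x\<in>P1. \<forall>y\<in>P1. \<kappa> (g x) (g y) = d * c x * c y * \<kappa> x y))"

lemma \<kappa>_conformalI: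
  fixes d :: real
  assumes "g ` P1 \<subseteq> P1" "g' ` P1 \<subseteq> P1" "\<And>x. x \<in> P1 \<Longrightarrow> g' (g x) = x" "\<And>x. x \<in> P1 \<Longrightarrow> g (g' x) = x"
    and "d\<^sup>2 = 1" "\<And>x. x \<in> P1 \<Longrightarrow> (c x)\<^sup>2 = 1"
    and "\<And>x y. x \<in> P1 \<Longrightarrow> y \<in> P1 \<Longrightarrow> x \<noteq> y \<Longrightarrow> \<kappa> (g x) (g y) = d * c x * c y * \<kappa> x y"
  shows "\<kappa>_conformal g"
proof -
  have "bij_betw g P1 P1"
    using assms(1-4) by (intro bij_betw_byWitness[of _ g']) auto
  moreover have "\<kappa> (g x) (g y) = d * c x * c y * \<kappa> x y" if "x \<in> P1" "y \<in> P1" for x y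
    using assms(7)[OF that] by (cases "x = y") auto
  ultimately show ?thesis using assms(5,6) unfolding \<kappa>_conformal_def by blast
qed

definition shift :: "int \<Rightarrow> int option \<Rightarrow> int option" where
  "shift t = map_option (\<lambda>a. (a + t) mod int p)"

definition dilate :: "int \<Rightarrow> int option \<Rightarrow> int option" where
  "dilate \<alpha> = map_option (\<lambda>a. \<alpha> * a mod int p)"

abbreviation inv_mod :: "int \<Rightarrow> int" where
  "inv_mod \<equiv> modular_inverse (int p)"

definition invert :: "int option \<Rightarrow> int option" where
  "invert x = (case x of None \<Rightarrow> Some 0 | Some a \<Rightarrow> if a = 0 then None else Some (inv_mod a))"

lemma shift_P1: "x \<in> P1 \<Longrightarrow> shift t x \<in> P1"
  using mod_in_F by (cases x) (auto simp: shift_def)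

lemma shift_shift: "shift s (shift t x) = shift (s + t) x"
  by (cases x) (simp_all add: shift_def mod_simps algebra_simps)

lemma shift_mod: "shift (t mod int p) x = shift t x"
  by (cases x) (simp_all add: shift_def mod_simps)

lemma shift_0: "x \<in> P1 \<Longrightarrow> shift 0 x = x"
  by (cases x) (auto simp: shift_def)

lemma shift_uminus_cancel: "x \<in> P1 \<Longrightarrow> shift t (shift (- t) x) = x"
  by (simp add: shift_shift shift_0)

lemma dilate_P1: "x \<in> P1 \<Longrightarrow> dilate \<alpha> x \<in> P1"
  using mod_in_F by (cases x) (auto simp: dilate_def)

lemma dilate_shift: "dilate \<alpha> (shift t x) = shift (\<alpha> * t) (dilate \<alpha> x)"
  by (cases x) (simp_all add: shift_def dilate_def mod_simps algebra_simps)

lemma dilate_cancel: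
  assumes "[\<alpha> * \<beta> = 1] (mod int p)" "x \<in> P1"
  shows "dilate \<alpha> (dilate \<beta> x) = x"
proof (cases x)
  case (Some a)
  have "[\<alpha> * \<beta> * a = 1 * a] (mod int p)"
    by (intro cong_mult assms cong_refl)
  then show ?thesis using assms(2) Some by (simp add: dilate_def cong_def mod_simps mult.assoc)
qed (simp add: dilate_def)

lemma cong_inv_mod:
  assumes "\<not> int p dvd a"
  shows "[a * inv_mod a = 1] (mod int p)"
  using assms by (intro cong_modular_inverse1) (simp add: coprime_p_iff)

lemma inv_mod_in_F: "inv_mod a \<in> F"
  using p_pos by (simp add: modular_inverse_int_nonneg modular_inverse_int_less)

lemma inv_mod_nonzero: "\<not> int p dvd a \<Longrightarrow> inv_mod a \<noteq> 0"
  using cong_inv_mod[of a] p_gt_2 by (auto simp: cong_def)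

lemma inv_mod_inv_mod:
  assumes "a \<in> F" "a \<noteq> 0"
  shows "inv_mod (inv_mod a) = a"
  using assms cong_inv_mod[OF not_dvd_nonzero_residue[OF assms]]
  by (intro modular_inverse_int_eqI) (simp_all add: mult.commute)

lemma invert_None: "invert None = Some 0"
  by (simp add: invert_def)

lemma invert_P1: "x \<in> P1 \<Longrightarrow> invert x \<in> P1"
  using inv_mod_in_F p_pos by (cases x) (auto simp: invert_def)

lemma invert_invert: "x \<in> P1 \<Longrightarrow> invert (invert x) = x"
  by (cases x) (auto simp: invert_def inv_mod_inv_mod inv_mod_nonzero not_dvd_nonzero_residue)

lemma \<kappa>_conformal_shift: "\<kappa>_conformal (shift t)"
proof (rule \<kappa>_conformalI[of _ "shift (- t)" 1 "\<lambda>_. 1"])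
  fix x y
  show "\<kappa> (shift t x) (shift t y) = 1 * 1 * 1 * \<kappa> x y"
    by (cases x; cases y) (auto simp: shift_def cong_def mod_simps intro!: chi_cong)
qed (auto simp: shift_P1 shift_shift shift_0)

lemma \<kappa>_conformal_dilate:
  assumes \<alpha>: "\<not> int p dvd \<alpha>"
  shows "\<kappa>_conformal (dilate \<alpha>)"
proof (rule \<kappa>_conformalI[of _ "dilate (inv_mod \<alpha>)" "chi \<alpha>" "\<lambda>x. if x = None then chi \<alpha> else 1"])
  fix x y :: "int option" assume "x \<noteq> y"
  have "chi (\<alpha> * a mod int p - \<alpha> * b mod int p) = chi \<alpha> * chi (a - b)" for a b
    unfolding chi_mult[symmetric]
    by (rule chi_cong) (simp add: cong_def mod_simps right_diff_distrib)
  then show "\<kappa> (dilate \<alpha> x) (dilate \<alpha> y) =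
      chi \<alpha> * (if x = None then chi \<alpha> else 1) * (if y = None then chi \<alpha> else 1) * \<kappa> x y"
    using chi_sq[OF \<alpha>] \<open>x \<noteq> y\<close>
    by (cases x; cases y) (simp_all add: dilate_def power2_eq_square)
next
  fix x assume "x \<in> P1"
  then show "dilate (inv_mod \<alpha>) (dilate \<alpha> x) = x" "dilate \<alpha> (dilate (inv_mod \<alpha>) x) = x"
    using cong_inv_mod[OF \<alpha>] by (simp_all add: dilate_cancel mult.commute)
qed (use \<alpha> in \<open>auto simp: dilate_P1 chi_sq\<close>)

lemma chi_mult_self: "\<not> int p dvd a \<Longrightarrow> chi a * (chi a * z) = z"
  using chi_sq[of a] by (simp add: power2_eq_square flip: mult.assoc)

lemma chi_inv_mod:
  assumes "\<not> int p dvd a"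
  shows "chi (inv_mod a) = chi a"
proof -
  have "chi (a * inv_mod a * a) = chi (1 * a)"
    by (intro chi_cong cong_mult cong_inv_mod assms cong_refl)
  then have "chi a * (chi a * chi (inv_mod a)) = chi a"
    by (simp add: chi_mult mult_ac)
  then show ?thesis by (simp add: chi_mult_self[OF assms])
qed

lemma chi_inv_mod_diff:
  assumes "\<not> int p dvd a" "\<not> int p dvd b"
  shows "chi (inv_mod a - inv_mod b) = chi a * chi b * chi (a - b)"
proof -
  have "[(a * inv_mod a) * b - (b * inv_mod b) * a = 1 * b - 1 * a] (mod int p)"
    by (intro cong_diff cong_mult cong_inv_mod assms cong_refl)
  then have "chi (a * (b * (inv_mod a - inv_mod b))) = chi (b - a)"
    by (intro chi_cong) (simp add: algebra_simps)
  then have "chi b * (chi a * (chi a * (chi b * chi (inv_mod a - inv_mod b)))) =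
      chi b * (chi a * chi (a - b))"
    by (simp add: chi_mult chi_diff_commute[of b])
  then show ?thesis using assms by (simp add: chi_mult_self mult_ac)
qed

lemma \<kappa>_conformal_invert: "\<kappa>_conformal invert"
proof -
  let ?c = "\<lambda>x. case x of None \<Rightarrow> 1 | Some a \<Rightarrow> if a = 0 then 1 else chi a"
  show ?thesis
  proof (rule \<kappa>_conformalI[of _ invert 1 ?c])
    fix x assume "x \<in> P1"
    then show "(?c x)\<^sup>2 = 1"
      by (cases x) (auto simp: not_dvd_nonzero_residue chi_sq)
  next
    fix x y assume "x \<in> P1" "y \<in> P1" "x \<noteq> y"
    moreover have "chi a * chi a = 1" if "\<not> int p dvd a" for a
      using chi_sq[OF that] by (simp add: power2_eq_square)
    ultimately show "\<kappa> (invert x) (invert y) = 1 * ?c x * ?c y * \<kappa> x y"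
      by (cases x; cases y)
        (auto simp: invert_def not_dvd_nonzero_residue chi_inv_mod_diff
            chi_uminus chi_inv_mod chi_mult_self)
  qed (auto simp: invert_P1 invert_invert)
qed

section \<open>The matrix on pairs of points of the projective line\<close>

definition pairs_P1 :: "int option set set" where
  "pairs_P1 = {S. S \<subseteq> P1 \<and> card S = 2}"

definition T :: "int option set \<Rightarrow> int option set \<Rightarrow> real" where
  "T S U = (\<Prod>x\<in>S. \<Prod>y\<in>U. \<kappa> x y)"

lemma finite_pairs_P1: "finite pairs_P1"
  using finite_P1 by (simp add: pairs_P1_def)

lemma T_commute: "T S U = T U S"
  unfolding T_def by (subst prod.swap) (simp add: \<kappa>_commute)

lemma T_Some_image:
  assumes "finite S" "finite U"
  shows "T (Some ` S) (Some ` U) = T441 p S U"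
proof (cases "S \<inter> U = {}")
  case True
  then show ?thesis by (simp add: T_def T441_def prod.reindex chi_def)
next
  case False
  then obtain a where "a \<in> S" "a \<in> U" by blast
  then have "(\<Prod>y\<in>Some ` U. \<kappa> (Some a) y) = 0"
    using assms(2) by (intro prod_zero) (auto intro!: bexI[of _ a] simp: chi_0)
  then have "T (Some ` S) (Some ` U) = 0"
    unfolding T_def using assms(1) \<open>a \<in> S\<close> by (intro prod_zero) auto
  then show ?thesis using False by (simp add: T441_def)
qed

lemma bij_betw_pairs_P1:
  assumes "\<kappa>_conformal g"
  shows "bij_betw ((`) g) pairs_P1 pairs_P1"
proof -
  have g: "inj_on g P1" "g ` P1 = P1"
    using assms by (auto simp: \<kappa>_conformal_def bij_betw_def)
  have "inj_on ((`) g) pairs_P1"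
    using inj_on_image_Pow[OF g(1)] by (rule inj_on_subset) (auto simp: pairs_P1_def)
  moreover have "(`) g ` pairs_P1 \<subseteq> pairs_P1"
    using g by (auto simp: pairs_P1_def card_image inj_on_subset)
  ultimately show ?thesis
    by (simp add: bij_betw_def endo_inj_surj finite_pairs_P1)
qed

lemma kernel_invariant_T:
  assumes g: "\<kappa>_conformal g"
  shows "kernel_invariant pairs_P1 T ((`) g)"
  unfolding kernel_invariant_def
proof (intro ballI)
  fix S U assume SU: "S \<in> pairs_P1" "U \<in> pairs_P1"
  obtain d c where d: "d\<^sup>2 = 1" and c: "\<And>x. x \<in> P1 \<Longrightarrow> (c x)\<^sup>2 = 1"
    and \<kappa>_g: "\<And>x y. x \<in> P1 \<Longrightarrow> y \<in> P1 \<Longrightarrow> \<kappa> (g x) (g y) = d * c x * c y * \<kappa> x y"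
    using g unfolding \<kappa>_conformal_def by blast
  obtain a b where S: "S = {a, b}" "a \<noteq> b" "a \<in> P1" "b \<in> P1"
    using SU(1) by (auto simp: pairs_P1_def card_2_iff)
  obtain e f where U: "U = {e, f}" "e \<noteq> f" "e \<in> P1" "f \<in> P1"
    using SU(2) by (auto simp: pairs_P1_def card_2_iff)
  have "inj_on g P1" using g by (auto simp: \<kappa>_conformal_def bij_betw_def)
  then have "g a \<noteq> g b" "g e \<noteq> g f" using S U by (auto simp: inj_on_eq_iff)
  then have "T (g ` S) (g ` U) =
      (d\<^sup>2)\<^sup>2 * (c a)\<^sup>2 * (c b)\<^sup>2 * (c e)\<^sup>2 * (c f)\<^sup>2 * (\<kappa> a e * \<kappa> a f * (\<kappa> b e * \<kappa> b f))"
    using S U by (simp add: T_def \<kappa>_g power2_eq_square)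
  also have "\<dots> = T S U" using S U by (simp add: T_def c d)
  finally show "T (g ` S) (g ` U) = T S U" .
qed

lemma pairs_P1_transitive:
  assumes "S \<in> pairs_P1"
  shows "\<exists>s t. S = shift t ` invert ` shift s ` {None, Some 0}"
proof -
  obtain x y where S: "S = {x, y}" "x \<noteq> y" "x \<in> P1" "y \<in> P1"
    using assms by (auto simp: pairs_P1_def card_2_iff)
  then obtain t y where ty: "S = {Some t, y}" "y \<noteq> Some t" "t \<in> F" "y \<in> P1"
    by (cases x; cases y) (auto simp: insert_commute)
  define z where "z = shift (- t) y"
  have z: "z \<in> P1" "shift t z = y" using ty by (simp_all add: z_def shift_P1 shift_uminus_cancel)
  have shift_t_0: "shift t (Some 0) = Some t" using ty by (simp add: shift_def)
  then have "z \<noteq> Some 0" using z ty by auto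
  then have "invert z \<noteq> None"
    using invert_invert[OF z(1)] invert_None by metis
  then obtain s where s: "invert z = Some s" by blast
  then have "s \<in> F" "invert (Some s) = z" using invert_P1[OF z(1)] invert_invert[OF z(1)] by auto
  then have "shift t ` invert ` shift s ` {None, Some 0} = {shift t (invert None), shift t z}"
    by (simp add: shift_def)
  also have "\<dots> = S" using ty z shift_t_0 by (simp add: invert_None)
  finally show ?thesis by metis
qed

sublocale pgl: projective_action p pairs_P1 "\<lambda>t. (`) (shift t)" "\<lambda>\<alpha>. (`) (dilate \<alpha>)" "(`) invert"
  "{None, Some 0}"
proof
  fix S t \<alpha> assume "\<alpha> \<in> {1..<int p}"
  then have "\<not> int p dvd \<alpha>" by (intro not_dvd_nonzero_residue) auto
  then show "bij_betw ((`) (dilate \<alpha>)) pairs_P1 pairs_P1"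
    by (intro bij_betw_pairs_P1 \<kappa>_conformal_dilate)
  show "dilate \<alpha> ` shift t ` S = shift (\<alpha> * t) ` dilate \<alpha> ` S"
    by (simp add: image_image dilate_shift)
next
  fix S t assume S: "S \<in> pairs_P1"
  then have "S \<subseteq> P1" by (simp add: pairs_P1_def)
  then show "shift 0 ` S = S" using shift_0 by force
  show "shift t ` S \<in> pairs_P1"
    by (rule bij_betw_apply[OF bij_betw_pairs_P1[OF \<kappa>_conformal_shift] S])
  show "\<exists>s t. S = shift t ` invert ` shift s ` {None, Some 0}"
    by (rule pairs_P1_transitive[OF S])
next
  show "{None, Some 0} \<in> pairs_P1" using p_pos by (simp add: pairs_P1_def)
qed (auto simp: p_pos prime_p finite_pairs_P1 image_image shift_shift shift_mod
    bij_betw_pairs_P1 \<kappa>_conformal_invert)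

lemma invariant_T: "pgl.invariant T"
  unfolding pgl.invariant_def
  by (intro conjI allI ballI kernel_invariant_T \<kappa>_conformal_shift \<kappa>_conformal_dilate
      \<kappa>_conformal_invert not_dvd_nonzero_residue) auto

abbreviation T_sq :: "int option set \<Rightarrow> int option set \<Rightarrow> real" where
  "T_sq \<equiv> kernel_comp pairs_P1 T T"

lemma invariant_T_sq: "pgl.invariant T_sq"
  by (intro pgl.invariant_comp invariant_T)

lemma T_sq_commute: "T_sq S U = T_sq U S"
  unfolding kernel_comp_def by (simp add: T_commute[of S] T_commute[of _ U] mult.commute)

lemma two_T_sq_eq:
  assumes k: "\<And>e. k e = (\<Prod>x\<in>S. \<kappa> x e) * (\<Prod>y\<in>U. \<kappa> y e)"
  shows "2 * T_sq S U = (\<Sum>e\<in>P1. k e)\<^sup>2 - (\<Sum>e\<in>P1. (k e)\<^sup>2)"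
proof -
  have "T S R * T R U = (\<Prod>e\<in>R. k e)" for R
    unfolding T_commute[of R U] unfolding T_def k prod.distrib
    by (simp only: prod.swap[of _ R])
  then have "T_sq S U = (\<Sum>R | R \<subseteq> P1 \<and> card R = 2. \<Prod>e\<in>R. k e)"
    by (simp add: kernel_comp_def pairs_P1_def)
  then show ?thesis using sum_prod_pairs[OF finite_P1, of k] by simp
qed

lemma T_row_sum_sq_le: "(\<Sum>U\<in>pairs_P1. T {None, Some 0} U)\<^sup>2 \<le> (real p)\<^sup>2"
proof -
  define k where "k = (\<lambda>e. \<kappa> None e * \<kappa> (Some 0) e)"
  have "T {None, Some 0} U = (\<Prod>e\<in>U. k e)" for U
    by (simp add: T_def k_def prod.distrib)
  then have "2 * (\<Sum>U\<in>pairs_P1. T {None, Some 0} U) = (\<Sum>e\<in>P1. k e)\<^sup>2 - (\<Sum>e\<in>P1. (k e)\<^sup>2)"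
    using sum_prod_pairs[OF finite_P1, of k] by (simp add: pairs_P1_def)
  also have "(\<Sum>e\<in>P1. k e) = 0"
    by (simp add: sum_P1 k_def chi_uminus sum_chi)
  also have "(\<Sum>e\<in>P1. (k e)\<^sup>2) = (\<Sum>e\<in>F. (chi e)\<^sup>2)"
    by (simp add: sum_P1 k_def chi_uminus)
  finally have "2 * (\<Sum>U\<in>pairs_P1. T {None, Some 0} U) = - (\<Sum>e\<in>F. (chi e)\<^sup>2)" by simp
  moreover have "0 \<le> (\<Sum>e\<in>F. (chi e)\<^sup>2)" by (simp add: sum_nonneg)
  moreover have "(\<Sum>e\<in>F. (chi e)\<^sup>2) \<le> real p"
    using sum_bounded_above[of F "\<lambda>e. (chi e)\<^sup>2" 1] abs_chi_le_1 by (simp add: abs_square_le_1)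
  ultimately have "\<bar>\<Sum>U\<in>pairs_P1. T {None, Some 0} U\<bar> \<le> \<bar>real p\<bar>" by linarith
  then show ?thesis by (simp only: abs_le_square_iff)
qed

definition root_poly :: "int set \<Rightarrow> int set \<Rightarrow> int poly" where
  "root_poly S U = (\<Prod>x\<in>S. [:- x, 1:]) * (\<Prod>y\<in>U. [:- y, 1:])"

definition char_sum :: "int set \<Rightarrow> int set \<Rightarrow> real" where
  "char_sum S U = (\<Sum>e\<in>F. chi (poly (root_poly S U) e))"

lemma poly_root_poly: "poly (root_poly S U) e = (\<Prod>x\<in>S. e - x) * (\<Prod>y\<in>U. e - y)"
  by (simp add: root_poly_def poly_prod)

lemma chi_poly_root_poly:
  "chi (poly (root_poly S U) e) = (\<Prod>x\<in>S. chi (x - e)) * (\<Prod>y\<in>U. chi (y - e))"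
  by (simp add: poly_root_poly chi_mult chi_prod chi_diff_commute[of e])

lemma T_sq_affine_entry_sq_le:
  "(T_sq (Some ` S) (Some ` U))\<^sup>2 \<le> 2 * char_sum S U ^ 4 + (real p)\<^sup>2"
proof -
  define k where "k = (\<lambda>e. (\<Prod>x\<in>Some ` S. \<kappa> x e) * (\<Prod>y\<in>Some ` U. \<kappa> y e))"
  define M where "M = char_sum S U"
  define s where "s = (\<Sum>e\<in>P1. (k e)\<^sup>2)"
  have k_eq: "k None = 1" "k (Some e) = chi (poly (root_poly S U) e)" for e
    by (simp_all add: k_def prod.reindex chi_poly_root_poly)
  have "(k e)\<^sup>2 \<le> 1" for e
    using abs_chi_le_1 by (cases e) (simp_all add: k_eq abs_square_le_1)
  then have s_bounds: "0 \<le> s" "s \<le> real p + 1"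
    using sum_bounded_above[of P1 "\<lambda>e. (k e)\<^sup>2" 1]
    by (simp_all add: s_def sum_nonneg card_P1 add.commute)
  have "(\<Sum>e\<in>P1. k e) = 1 + M"
    by (simp add: sum_P1 k_eq M_def char_sum_def)
  then have "2 * T_sq (Some ` S) (Some ` U) = (1 + M)\<^sup>2 - s"
    using two_T_sq_eq[of k "Some ` S" "Some ` U"] by (simp add: k_def s_def)
  then have "4 * (T_sq (Some ` S) (Some ` U))\<^sup>2 = ((1 + M)\<^sup>2 - s)\<^sup>2"
    by (metis power_mult_distrib four_x_squared)
  also have "\<dots> \<le> ((1 + M)\<^sup>2)\<^sup>2 + s\<^sup>2"
    using s_bounds(1) by (simp add: power2_diff)
  also have "\<dots> \<le> (2 + 2 * M\<^sup>2)\<^sup>2 + (real p + 1)\<^sup>2"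
  proof (intro add_mono power_mono s_bounds)
    show "(1 + M)\<^sup>2 \<le> 2 + 2 * M\<^sup>2"
      using zero_le_power2[of "1 - M"] by (simp add: power2_eq_square algebra_simps)
  qed simp
  also have "(2 + 2 * M\<^sup>2)\<^sup>2 \<le> 8 + 8 * M ^ 4"
    using zero_le_power2[of "2 - 2 * M\<^sup>2"] by (simp add: power2_sum power2_diff power_mult_distrib)
  also have "8 + 8 * M ^ 4 + (real p + 1)\<^sup>2 \<le> 8 * M ^ 4 + 4 * (real p)\<^sup>2"
  proof -
    have "5 * real p \<le> (real p)\<^sup>2" using p_ge_5 by (simp add: power2_eq_square mult_right_mono)
    moreover have "5 \<le> real p" using p_ge_5 by simp
    ultimately show ?thesis by (simp add: power2_sum)
  qed
  finally show ?thesis by (simp add: M_def)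
qed

lemma pairs_modD:
  assumes "S \<in> pairs_mod p"
  shows "finite S" "card S = 2" "S \<subseteq> F"
  using assms finite_subset[of S F] by (auto simp: pairs_mod_def)

lemma roots_subset_if_root_poly_cong:
  assumes finite: "finite S" "finite U" "finite S'" "finite U'"
    and subset: "S \<union> U \<subseteq> F" "S' \<union> U' \<subseteq> F"
    and cong: "\<And>x. [poly (root_poly S' U') x = poly (root_poly S U) x] (mod int p)"
  shows "S' \<union> U' \<subseteq> S \<union> U"
proof
  fix x assume x: "x \<in> S' \<union> U'"
  then have "poly (root_poly S' U') x = 0"
    using finite by (auto simp: poly_root_poly)
  then have "int p dvd poly (root_poly S U) x"
    using cong_sym[OF cong[of x]] by (simp add: cong_0_iff)
  then obtain y where y: "y \<in> S \<union> U" "int p dvd x - y"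
    using finite prime_p by (auto simp: poly_root_poly prime_dvd_mult_iff prime_dvd_prod_iff)
  then have "x = y" using x subset residue_dvd_diff_iff[of x "int p" y] by blast
  with y(1) show "x \<in> S \<union> U" by simp
qed

lemma sum_char_sum_power4_le:
  "(\<Sum>S\<in>pairs_mod p. \<Sum>U\<in>pairs_mod p. char_sum S U ^ 4) \<le> 768 * real p ^ 6"
proof -
  let ?I = "pairs_mod p \<times> pairs_mod p" and ?R = "\<lambda>(S, U). root_poly S U"
  have "finite (pairs_mod p)" by (simp add: pairs_mod_def)
  then have "(\<Sum>i\<in>?I. (\<Sum>x\<in>F. chi (poly (?R i) x)) ^ 4) \<le> 3 * real 256 * real p ^ (4 + 2)"
  proof (intro fourth_moment_monic_family)
    fix i assume "i \<in> ?I"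
    then obtain S U where i: "i = (S, U)" and SU: "S \<in> pairs_mod p" "U \<in> pairs_mod p" by blast
    note SU_D = pairs_modD[OF SU(1)] pairs_modD[OF SU(2)]
    show "degree (?R i) = 4"
      using SU_D by (simp add: i root_poly_def degree_mult_eq degree_prod_sum_eq)
    show "lead_coeff (?R i) = 1"
      by (simp add: i root_poly_def lead_coeff_mult lead_coeff_prod)
    let ?fibre = "{j \<in> ?I. \<forall>x. [poly (?R j) x = poly (?R i) x] (mod int p)}"
    have "S' \<union> U' \<subseteq> S \<union> U" if "(S', U') \<in> ?fibre" for S' U'
      using that SU_D pairs_modD[of S'] pairs_modD[of U']
      by (intro roots_subset_if_root_poly_cong) (auto simp: i)
    then have "?fibre \<subseteq> Pow (S \<union> U) \<times> Pow (S \<union> U)" by auto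
    then have "card ?fibre \<le> card (Pow (S \<union> U) \<times> Pow (S \<union> U))"
      using SU_D by (intro card_mono) auto
    also have "\<dots> = 2 ^ card (S \<union> U) * 2 ^ card (S \<union> U)"
      using SU_D by (simp add: card_cartesian_product card_Pow)
    also have "\<dots> \<le> 2 ^ 4 * 2 ^ 4"
      using SU_D card_Un_le[of S U] by (intro mult_le_mono power_increasing) simp_all
    finally show "card ?fibre \<le> 256" by simp
  qed simp_all
  then show ?thesis
    by (simp add: char_sum_def sum.cartesian_product case_prod_beta)
qed

lemma card_pairs_mod: "2 * real (card (pairs_mod p)) = real p * (real p - 1)"
  using card_pairs[of F] by (simp add: pairs_mod_def)

lemma sum_T_sq_affine_entry_sq_le:
  "(\<Sum>S\<in>pairs_mod p. \<Sum>U\<in>pairs_mod p. (T_sq (Some ` S) (Some ` U))\<^sup>2) \<le> 1537 * real p ^ 6"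
proof -
  have "(\<Sum>S\<in>pairs_mod p. \<Sum>U\<in>pairs_mod p. (T_sq (Some ` S) (Some ` U))\<^sup>2)
      \<le> (\<Sum>S\<in>pairs_mod p. \<Sum>U\<in>pairs_mod p. 2 * char_sum S U ^ 4 + (real p)\<^sup>2)"
    by (intro sum_mono T_sq_affine_entry_sq_le)
  also have "\<dots> = 2 * (\<Sum>S\<in>pairs_mod p. \<Sum>U\<in>pairs_mod p. char_sum S U ^ 4)
      + (real (card (pairs_mod p)))\<^sup>2 * (real p)\<^sup>2"
    by (simp add: sum.distrib sum_distrib_left power2_eq_square)
  also have "\<dots> \<le> 2 * (768 * real p ^ 6) + ((real p)\<^sup>2)\<^sup>2 * (real p)\<^sup>2"
  proof (intro add_mono mult_left_mono mult_right_mono power_mono sum_char_sum_power4_le)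
    have "2 * real (card (pairs_mod p)) \<le> real p * (2 * real p)"
      unfolding card_pairs_mod by (intro mult_left_mono) simp_all
    then show "real (card (pairs_mod p)) \<le> (real p)\<^sup>2" by (simp add: power2_eq_square)
  qed auto
  also have "\<dots> = 1537 * real p ^ 6" by (simp flip: power_mult power_add)
  finally show ?thesis .
qed

text \<open>A pair contains \<open>None\<close> with probability \<open>2 / (p + 1)\<close>, so by homogeneity the pairs inside
  \<open>\<F>\<^sub>p\<close> carry a fixed proportion of the Frobenius norm.\<close>

lemma frobenius_sq_T_sq_le_affine:
  "frobenius_sq pairs_P1 T_sq \<le>
    3 * (\<Sum>S\<in>pairs_mod p. \<Sum>U\<in>pairs_mod p. (T_sq (Some ` S) (Some ` U))\<^sup>2)" (is "_ \<le> 3 * ?f")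
proof -
  define Y where "Y = (`) Some ` pairs_mod p"
  have inj: "inj_on ((`) Some) (pairs_mod p)"
    by (simp add: inj_on_def inj_image_eq_iff)
  have Y: "Y \<subseteq> pairs_P1"
    by (auto simp: Y_def pairs_mod_def pairs_P1_def card_image)
  have card_Y: "2 * real (card Y) = real p * (real p - 1)"
    using inj card_pairs_mod by (simp add: Y_def card_image)
  have card_X: "2 * real (card pairs_P1) = (real p + 1) * real p"
    using card_pairs[OF finite_P1] by (simp add: pairs_P1_def card_P1)
  have "pgl.invariant (\<lambda>S U. (T_sq S U)\<^sup>2)"
    using invariant_T_sq by (simp add: pgl.invariant_def kernel_invariant_def)
  then have "(2 * real (card Y) - real (card pairs_P1)) * frobenius_sq pairs_P1 T_sq
      \<le> real (card pairs_P1) * (\<Sum>S\<in>Y. \<Sum>U\<in>Y. (T_sq S U)\<^sup>2)"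
    unfolding frobenius_sq_def using Y T_sq_commute by (intro pgl.sum_square_subset_ge) auto
  also have "(\<Sum>S\<in>Y. \<Sum>U\<in>Y. (T_sq S U)\<^sup>2) = ?f"
    using inj by (simp add: Y_def sum.reindex)
  finally have "(2 * (2 * real (card Y)) - 2 * real (card pairs_P1)) * frobenius_sq pairs_P1 T_sq
      \<le> (2 * real (card pairs_P1)) * ?f"
    by (simp add: algebra_simps)
  then have "real p * ((real p - 3) * frobenius_sq pairs_P1 T_sq) \<le> real p * ((real p + 1) * ?f)"
    unfolding card_Y card_X by (simp add: algebra_simps)
  then have "(real p - 3) * frobenius_sq pairs_P1 T_sq \<le> (real p + 1) * ?f"
    using p_pos by simp
  also have "\<dots> \<le> ((real p - 3) * 3) * ?f"
    using p_ge_5 by (intro mult_right_mono sum_nonneg) auto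
  finally have "(real p - 3) * frobenius_sq pairs_P1 T_sq \<le> (real p - 3) * (3 * ?f)"
    by (simp only: mult.assoc)
  then show ?thesis
    by (rule mult_left_le_imp_le) (use p_ge_5 in simp)
qed

lemma frobenius_sq_T_sq_le: "frobenius_sq pairs_P1 T_sq \<le> real (p - 1) * (10 ^ 4 * real p ^ 5)"
proof -
  have "frobenius_sq pairs_P1 T_sq \<le> 3 * (1537 * real p ^ 6)"
    using frobenius_sq_T_sq_le_affine sum_T_sq_affine_entry_sq_le by linarith
  also have "\<dots> \<le> 8000 * real p ^ 6" by simp
  also have "\<dots> = (4 / 5 * real p) * (10 ^ 4 * real p ^ 5)" by (simp flip: power_Suc)
  also have "\<dots> \<le> real (p - 1) * (10 ^ 4 * real p ^ 5)"
    using p_ge_5 by (intro mult_right_mono) (simp_all add: of_nat_diff)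
  finally show ?thesis .
qed

lemma norm_sq_T_le:
  "(norm_sq pairs_P1 (kernel_apply pairs_P1 T v))\<^sup>2
    \<le> 10 ^ 4 * real p ^ 5 * (norm_sq pairs_P1 v)\<^sup>2"
proof -
  have "(\<Sum>U\<in>pairs_P1. T_sq {None, Some 0} U)\<^sup>2 = ((\<Sum>U\<in>pairs_P1. T {None, Some 0} U)\<^sup>2)\<^sup>2"
    by (simp only: pgl.row_sum_comp[OF invariant_T] power2_eq_square mult_ac)
  also have "\<dots> \<le> ((real p)\<^sup>2)\<^sup>2"
    by (intro power_mono T_row_sum_sq_le) simp
  also have "\<dots> = real p ^ 4" by (simp flip: power_mult)
  also have "\<dots> \<le> real p ^ 5" using p_pos by (intro power_increasing) simp_all
  also have "\<dots> \<le> 10 ^ 4 * real p ^ 5" by simp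
  finally have "(\<Sum>U\<in>pairs_P1. T_sq {None, Some 0} U)\<^sup>2 \<le> 10 ^ 4 * real p ^ 5" .
  then have "norm_sq pairs_P1 v * norm_sq pairs_P1 (kernel_apply pairs_P1 T_sq v)
      \<le> norm_sq pairs_P1 v * (10 ^ 4 * real p ^ 5 * norm_sq pairs_P1 v)"
    by (intro mult_left_mono pgl.norm_sq_kernel_apply_invariant_le invariant_T_sq
        frobenius_sq_T_sq_le norm_sq_nonneg)
  with symmetric_kernel_norm_sq_le[of T pairs_P1 v] show ?thesis
    by (simp add: T_commute power2_eq_square mult_ac)
qed

section \<open>The operator norm\<close>

lemma T441_L2_bound:
  "L2_set (\<lambda>S. \<Sum>U\<in>pairs_mod p. T441 p S U * x U) (pairs_mod p)
    \<le> 10 * real p powr (5 / 4) * L2_set x (pairs_mod p)"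
proof -
  let ?I = "pairs_mod p"
  let ?y = "\<lambda>S. \<Sum>U\<in>?I. T441 p S U * x U"
  have "inj_on ((`) Some) ?I" "(`) Some ` ?I \<subseteq> pairs_P1"
    by (auto simp: inj_on_def inj_image_eq_iff pairs_mod_def pairs_P1_def card_image)
  then obtain v where norm_v: "norm_sq pairs_P1 v = norm_sq ?I x"
    and submatrix_le: "norm_sq ?I (kernel_apply ?I (\<lambda>S U. T (Some ` S) (Some ` U)) x)
      \<le> norm_sq pairs_P1 (kernel_apply pairs_P1 T v)"
    by (rule norm_sq_submatrix_le[OF finite_pairs_P1])
  have "kernel_apply ?I (\<lambda>S U. T (Some ` S) (Some ` U)) x S = ?y S" if "S \<in> ?I" for S
    unfolding kernel_apply_def inner_on_def using that
    by (intro sum.cong refl) (auto simp: pairs_mod_def T_Some_image finite_subset)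
  then have "norm_sq ?I ?y \<le> norm_sq pairs_P1 (kernel_apply pairs_P1 T v)"
    using submatrix_le by (simp add: inner_on_def)
  then have "(norm_sq ?I ?y)\<^sup>2 \<le> (norm_sq pairs_P1 (kernel_apply pairs_P1 T v))\<^sup>2"
    by (intro power_mono norm_sq_nonneg)
  also have "\<dots> \<le> 10 ^ 4 * real p ^ 5 * (norm_sq ?I x)\<^sup>2"
    using norm_sq_T_le[of v] unfolding norm_v .
  finally have "(norm_sq ?I ?y)\<^sup>2 \<le> 10 ^ 4 * real p ^ 5 * (norm_sq ?I x)\<^sup>2" .
  moreover have "(norm_sq ?I z)\<^sup>2 = L2_set z ?I ^ 4" for z
  proof -
    have "L2_set z ?I ^ 4 = ((L2_set z ?I)\<^sup>2)\<^sup>2" by (simp flip: power_mult)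
    then show ?thesis by (simp add: L2_set_def norm_sq_eq_sum sum_nonneg)
  qed
  moreover have "(real p powr (5 / 4)) ^ 4 = real p ^ 5"
    using p_pos by (simp add: powr_power powr_realpow[of "real p" 5, symmetric, simplified])
  ultimately have "L2_set ?y ?I ^ 4 \<le> (10 * real p powr (5 / 4) * L2_set x ?I) ^ 4"
    by (simp add: power_mult_distrib)
  then show ?thesis
    by (rule power_le_imp_le_base[of _ 3, simplified]) (simp add: L2_set_nonneg)
qed

lemma abs_opnorm_T441_le: "\<bar>matrix_opnorm (pairs_mod p) (T441 p)\<bar> \<le> 10 * real p powr (5 / 4)"
  by (rule abs_matrix_opnorm_le[OF _ _ T441_L2_bound]) (simp_all add: pairs_mod_def)

end

theorem theorem3p33:
  shows "(\<lambda>p::nat. matrix_opnorm (pairs_mod p) (T441 p))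
    \<in> O[inf at_top (principal {p. prime p \<and> [p = 1] (mod 4)})](\<lambda>p. real p powr (5/4))"
proof (rule bigoI[of _ 10])
  have "norm (matrix_opnorm (pairs_mod p) (T441 p)) \<le> 10 * norm (real p powr (5/4))"
    if "prime p" "[p = 1] (mod 4)" for p :: nat
  proof -
    have "p \<noteq> 2" "2 \<le> p" using that prime_ge_2_nat by (auto simp: cong_def)
    then interpret paley_prime p
      by unfold_locales (use that in \<open>auto simp: cong_def\<close>)
    show ?thesis using abs_opnorm_T441_le by simp
  qed
  then show "\<forall>\<^sub>F p in inf at_top (principal {p. prime p \<and> [p = 1] (mod 4)}).
      norm (matrix_opnorm (pairs_mod p) (T441 p)) \<le> 10 * norm (real p powr (5/4))"
    unfolding eventually_inf_principal by (intro always_eventually) auto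
qed

end
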